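(* Let $(X_{n,i})_{1\le i\le n,\,n\in\mathbb N}$ be a row-wise stationary array of $E$-valued random variables, with $v_n:=\mathbb P\{X_{n,1}\neq 0\}>0$, let $(r_n)$ be a sequence of positive integers with $r_n\ll v_n^{-1}\ll n$, put $m_n:=\lfloor n/r_n\rfloor$, and let $Y_{n,j}$ $(1\le j\le m_n)$, $Y_n$ be the associated blocks. Let $\mathcal F$ be a class of cluster functionals and let $(Z_n(f))_{f\in\mathcal F}$ be the empirical process of cluster functionals. Suppose that: (1) for all $\epsilon>0$ and all $f\in\mathcal F$, $\mathbb E\big[(f(Y_n)-\mathbb E f(Y_n))^2\,\mathbf 1\{|f(Y_n)-\mathbb E f(Y_n)|>\epsilon\sqrt{n v_n}\}\big]=o(r_nv_n)$; (2) there is a function $c:\mathcal F\times\mathcal F\to\mathbb R$ such that $(r_nv_n)^{-1}\operatorname{Cov}(f(Y_n),g(Y_n))\to c(f,g)$ as $n\to\infty$, for all $f,g\in\mathcal F$; (3) for every $k\in\mathbb N$, every $(f_1,\dots,f_k)\in\mathcal F^k$ and every $t\in\mathbb R^k$, $$T_t(m_n|f_1,\dots,f_k):=\sum_{j=1}^{m_n}\Big|\operatorname{Cov}\Big(e^{i\langle t,\sum_{s=1}^{j-1}W_{n,s}\rangle},\,e^{i\langle t,W_{n,j}\rangle}\Big)\Big|\longrightarrow 0\quad (n\to\infty),$$ where $W_{n,j}=W_{n,j}(f_1,\dots,f_k):=(nv_n)^{-1/2}\big(f_1(Y_{n,j})-\mathbb E f_1(Y_{n,j}),\dots,f_k(Y_{n,j})-\mathbb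 E f_k(Y_{n,j})\big)$. Then the finite-dimensional distributions of $(Z_n(f))_{f\in\mathcal F}$ converge weakly to those of a centered Gaussian process $(Z(f))_{f\in\mathcal F}$ with covariance function $c$.
   Context: Notation: $a_n\ll b_n$ means $a_n/b_n\to0$ as $n\to\infty$. $\langle\cdot,\cdot\rangle$ is the Euclidean inner product on $\mathbb R^k$. For complex-valued $U,V$, $\operatorname{Cov}(U,V)=\mathbb E[UV]-\mathbb E[U]\,\mathbb E[V]$; an empty sum is $0$. Setting: $(E,\mathcal E)$ is a measurable subspace of $(\mathbb R^d,\mathcal B(\mathbb R^d))$, $d\ge1$, with $0\in E$. $E_\cup:=\{(x_1,\dots,x_r): x_i\in E,\ r\in\mathbb N\}$ is the set of finite $E$-valued sequences, with the $\sigma$-field $\mathcal E_\cup$ induced by the Borel $\sigma$-fields on $E^r$, $r\in\mathbb N$. The core $x^c$ of $x=(x_1,\dots,x_r)\in E_\cup$ is $x^c:=(x_{r_I},x_{r_I+1},\dots,x_{r_S})$ if $x\ne 0_r$ (the null element of $E^r$), where $r_I=\min\{i:x_i\ne0\}$ and $r_S=\max\{i: x_i\neq0\}$, and $x^c:=0$ otherwise. A cluster functional is a measurable map $f:(E_\cup,\mathcal E_\cup)\to(\mathbb R,\mathcal B(\mathbb R))$ with $f(x)=f(x^c)$ for all $x\in E_\cup$ and $f(0_r)=0$ for all $r\ge1$. Array: "row-wise stationary" means $(X_{n,i})_{1\le i\le n}$ is stationary for each $n$. The blocks are $Y_{n,j}:=(X_{n,i})_{(j-1)r_n+1\le i\le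 jr_n}$, $1\le j\le m_n$; $Y_n$ denotes a generic block with the distribution of $Y_{n,1}$. The empirical process of cluster functionals is $$Z_n(f):=\frac1{\sqrt{nv_n}}\sum_{j=1}^{m_n}\big(f(Y_{n,j})-\mathbb E f(Y_{n,j})\big),\quad f\in\mathcal F.$$ *)

theory Defs
  imports "HOL-Probability.Probability"
begin

definition fin_seqs :: "'e set \<Rightarrow> 'e list set" where
  "fin_seqs E = {x. x \<noteq> [] \<and> set x \<subseteq> E}"

text \<open>
  The Borel \<open>\<sigma>\<close>-field of \<open>E\<^sup>r\<close> is the \<open>r\<close>-fold product of the Borel \<open>\<sigma>\<close>-field of \<open>E\<close>
  (second countability); it is transported to lists of length \<open>r\<close>. The generated \<open>\<sigma>\<close>-field
  consists of the sets whose intersection with each \<open>E\<^sup>r\<close> is Borel in \<open>E\<^sup>r\<close>.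
\<close>

definition fin_seqs_space :: "'e::topological_space set \<Rightarrow> 'e list measure" where
  "fin_seqs_space E = sigma (fin_seqs E)
     (\<Union>r\<in>{1..}. (\<lambda>B. (\<lambda>w. map w [0..<r]) ` B) `
        sets (PiM {..<r} (\<lambda>_. restrict_space borel E)))"

definition core :: "'e::zero list \<Rightarrow> 'e list" where
  "core x = (let S = {i. i < length x \<and> x ! i \<noteq> 0} in
     if S = {} then [0] else map (\<lambda>i. x ! i) [Min S..<Suc (Max S)])"

definition cluster_functional :: "'e::{topological_space, zero} set \<Rightarrow> ('e list \<Rightarrow> real) \<Rightarrow> bool" where
  "cluster_functional E f \<longleftrightarrow>
     f \<in> borel_measurable (fin_seqs_space E) \<and>
     (\<forall>x\<in>fin_seqs E. f x = f (core x)) \<and>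
     (\<forall>r\<ge>1. f (replicate r 0) = 0)"

definition stationary_row ::
  "'w measure \<Rightarrow> 'e measure \<Rightarrow> nat \<Rightarrow> (nat \<Rightarrow> 'w \<Rightarrow> 'e) \<Rightarrow> bool" where
  "stationary_row M S n X \<longleftrightarrow>
     (\<forall>J h. J \<subseteq> {1..n} \<and> (\<lambda>i. i + h) ` J \<subseteq> {1..n} \<longrightarrow>
        distr M (PiM J (\<lambda>_. S)) (\<lambda>\<omega>. \<lambda>i\<in>J. X (i + h) \<omega>) =
        distr M (PiM J (\<lambda>_. S)) (\<lambda>\<omega>. \<lambda>i\<in>J. X i \<omega>))"

text \<open>
  In the following, \<open>X n i\<close> is the \<open>i\<close>-th variable of the \<open>n\<close>-th row; only the indices
  \<open>1 \<le> i \<le> n\<close> are meaningful, and blocks are numbered from \<open>1\<close>.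
\<close>

definition nonzero_prob :: "'w measure \<Rightarrow> (nat \<Rightarrow> nat \<Rightarrow> 'w \<Rightarrow> 'e::zero) \<Rightarrow> nat \<Rightarrow> real" where
  "nonzero_prob M X n = \<P>(\<omega> in M. X n 1 \<omega> \<noteq> 0)"

definition num_blocks :: "(nat \<Rightarrow> nat) \<Rightarrow> nat \<Rightarrow> nat" where
  "num_blocks r n = n div r n"

definition block ::
  "(nat \<Rightarrow> nat \<Rightarrow> 'w \<Rightarrow> 'e) \<Rightarrow> (nat \<Rightarrow> nat) \<Rightarrow> nat \<Rightarrow> nat \<Rightarrow> 'w \<Rightarrow> 'e list" where
  "block X r n j \<omega> = map (\<lambda>i. X n i \<omega>) [(j - 1) * r n + 1..<j * r n + 1]"

definition centered_block ::
  "'w measure \<Rightarrow> (nat \<Rightarrow> nat \<Rightarrow> 'w \<Rightarrow> 'e) \<Rightarrow> (nat \<Rightarrow> nat) \<Rightarrow> ('e list \<Rightarrow> real) \<Rightarrow>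
    nat \<Rightarrow> nat \<Rightarrow> 'w \<Rightarrow> real" where
  "centered_block M X r f n j \<omega> =
     f (block X r n j \<omega>) - (LINT \<omega>'|M. f (block X r n j \<omega>'))"

definition emp_process ::
  "'w measure \<Rightarrow> (nat \<Rightarrow> nat \<Rightarrow> 'w \<Rightarrow> 'e::zero) \<Rightarrow> (nat \<Rightarrow> nat) \<Rightarrow> nat \<Rightarrow>
    ('e list \<Rightarrow> real) \<Rightarrow> 'w \<Rightarrow> real" where
  "emp_process M X r n f \<omega> =
     1 / sqrt (real n * nonzero_prob M X n) *
     (\<Sum>j=1..num_blocks r n. centered_block M X r f n j \<omega>)"

text \<open>There is no conjugation in the complex case.\<close>

definition cov ::
  "'w measure \<Rightarrow> ('w \<Rightarrow> 'b) \<Rightarrow> ('w \<Rightarrow> 'b::{real_normed_field, banach, second_countable_topology}) \<Rightarrow> 'b"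
  where
  "cov M U V = (LINT \<omega>|M. U \<omega> * V \<omega>) - (LINT \<omega>|M. U \<omega>) * (LINT \<omega>|M. V \<omega>)"

text \<open>Vectors of \<open>\<real>\<^sup>k\<close> are functions on \<open>{1..k}\<close>, so that \<open>k\<close> can be quantified over.\<close>

definition inner_upto :: "nat \<Rightarrow> (nat \<Rightarrow> real) \<Rightarrow> (nat \<Rightarrow> real) \<Rightarrow> real" where
  "inner_upto k t u = (\<Sum>i=1..k. t i * u i)"

definition block_vec ::
  "'w measure \<Rightarrow> (nat \<Rightarrow> nat \<Rightarrow> 'w \<Rightarrow> 'e::zero) \<Rightarrow> (nat \<Rightarrow> nat) \<Rightarrow> (nat \<Rightarrow> 'e list \<Rightarrow> real) \<Rightarrow>
    nat \<Rightarrow> nat \<Rightarrow> 'w \<Rightarrow> nat \<Rightarrow> real" where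
  "block_vec M X r fs n j \<omega> =
     (\<lambda>i. centered_block M X r (fs i) n j \<omega> / sqrt (real n * nonzero_prob M X n))"

definition dep_coeff ::
  "'w measure \<Rightarrow> (nat \<Rightarrow> nat \<Rightarrow> 'w \<Rightarrow> 'e::zero) \<Rightarrow> (nat \<Rightarrow> nat) \<Rightarrow> nat \<Rightarrow>
    (nat \<Rightarrow> 'e list \<Rightarrow> real) \<Rightarrow> (nat \<Rightarrow> real) \<Rightarrow> nat \<Rightarrow> real" where
  "dep_coeff M X r k fs t n =
     (\<Sum>j=1..num_blocks r n.
        cmod (cov M
          (\<lambda>\<omega>. iexp (inner_upto k t (\<lambda>i. \<Sum>s\<in>{1..<j}. block_vec M X r fs n s \<omega> i)))
          (\<lambda>\<omega>. iexp (inner_upto k t (block_vec M X r fs n j \<omega>)))))"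

definition gaussian_rv :: "'w measure \<Rightarrow> ('w \<Rightarrow> real) \<Rightarrow> bool" where
  "gaussian_rv M U \<longleftrightarrow> U \<in> borel_measurable M \<and>
     (\<exists>\<mu> \<sigma>. 0 \<le> \<sigma> \<and>
        distr M borel U =
          (if \<sigma> = 0 then return borel \<mu> else density lborel (\<lambda>x. ennreal (normal_density \<mu> \<sigma> x))))"

definition centered_gaussian_process ::
  "'w measure \<Rightarrow> 'i set \<Rightarrow> ('i \<Rightarrow> 'w \<Rightarrow> real) \<Rightarrow> ('i \<Rightarrow> 'i \<Rightarrow> real) \<Rightarrow> bool" where
  "centered_gaussian_process N I Z c \<longleftrightarrow>
     prob_space N \<and>
     (\<forall>J a. finite J \<and> J \<subseteq> I \<longrightarrow> gaussian_rv N (\<lambda>\<omega>. \<Sum>i\<in>J. a i * Z i \<omega>)) \<and>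
     (\<forall>i\<in>I. (LINT \<omega>|N. Z i \<omega>) = 0) \<and>
     (\<forall>i\<in>I. \<forall>j\<in>I. cov N (Z i) (Z j) = c i j)"

text \<open>The library's \<^const>\<open>weak_conv_m\<close> only covers measures on the real line.\<close>

definition weak_conv_on :: "'a topology \<Rightarrow> (nat \<Rightarrow> 'a measure) \<Rightarrow> 'a measure \<Rightarrow> bool" where
  "weak_conv_on T \<mu>s \<mu> \<longleftrightarrow>
     (\<forall>h. continuous_map T euclideanreal h \<and> bounded (h ` topspace T) \<longrightarrow>
        (\<lambda>n. LINT x|\<mu>s n. h x) \<longlonglongrightarrow> (LINT x|\<mu>. h x))"

definition fdd ::
  "'w measure \<Rightarrow> nat \<Rightarrow> (nat \<Rightarrow> 'i) \<Rightarrow> ('i \<Rightarrow> 'w \<Rightarrow> real) \<Rightarrow> (nat \<Rightarrow> real) measure" where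
  "fdd M k fs Z = distr M (PiM {1..k} (\<lambda>_. borel)) (\<lambda>\<omega>. \<lambda>i\<in>{1..k}. Z (fs i) \<omega>)"

definition fdds_converge ::
  "'i set \<Rightarrow> 'w measure \<Rightarrow> (nat \<Rightarrow> 'i \<Rightarrow> 'w \<Rightarrow> real) \<Rightarrow> 'v measure \<Rightarrow> ('i \<Rightarrow> 'v \<Rightarrow> real) \<Rightarrow> bool" where
  "fdds_converge I M Zs N Z \<longleftrightarrow>
     (\<forall>k fs. (\<forall>i\<in>{1..k}. fs i \<in> I) \<longrightarrow>
        weak_conv_on (product_topology (\<lambda>_. euclideanreal) {1..k})
          (\<lambda>n. fdd M k fs (Zs n)) (fdd N k fs Z))"

end

theory Submission
  imports Defs
begin

text \<open>
  Let \<open>Y\<^sub>n\<^sub>,\<^sub>j\<close> be the blocks and \<open>W\<^sub>n\<^sub>,\<^sub>j\<close> the centered vectors of functionals of a block, divided by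
  \<open>sqrt (n v\<^sub>n)\<close>. A linear combination of values of the empirical process is a row sum of the variables
  \<open>\<langle>t, W\<^sub>n\<^sub>,\<^sub>j\<rangle>\<close>, \<open>1 \<le> j \<le> m\<^sub>n\<close>. If these were independent, the Lindeberg theorem would give a normal limit:
  they are identically distributed by stationarity, their variances sum up to
  \<open>(m\<^sub>n r\<^sub>n / n) (r\<^sub>n v\<^sub>n)\<^sup>-\<^sup>1 Var \<langle>t, f(Y\<^sub>n)\<rangle> \<longlongrightarrow> \<Sum>\<Sum> t\<^sub>i t\<^sub>j c(f\<^sub>i, f\<^sub>j)\<close>, and the tail condition on each functional
  implies the one on linear combinations. Independence enters the proof of Lindeberg's theorem only through the
  factorization of the characteristic function of the sum. The error of this factorization is at most the sum of the
  covariances between \<open>e\<^sup>i\<^sup>S\<close> for the partial sum \<open>S\<close> up to \<open>j - 1\<close> and \<open>e\<^sup>i\<^sup>\<langle>\<^sup>t\<^sup>,\<^sup>W\<^sup>\<rangle>\<close> for the next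
  summand (\<open>char_sum_telescope\<close>), and this is the quantity which the dependence hypothesis sends to \<open>0\<close>. So the
  characteristic functions of the finite-dimensional distributions converge to Gaussian ones
  (\<open>char_row_sum_tendsto_gaussian\<close>, \<open>char_emp_process\<close>).

  Two facts about laws on finite-dimensional spaces complete the argument. First, pointwise convergence of
  characteristic functions to that of a probability measure implies weak convergence
  (\<open>tendsto_char_fun_imp_tendsto_integral\<close>): integrals of trigonometric polynomials converge by linearity, bounded
  continuous functions are approximated by these on large cubes, and the tails are controlled coordinate by coordinate
  with the theorem on the real line. As a special case, a law is determined by its characteristic function
  (\<open>measure_eqI_char_fun\<close>). Second, the limit process exists: \<open>c\<close> is symmetric and positive semidefinite as a
  limit of covariances (\<open>covariance_kernel_limit\<close>), so that it factorizes on every finite set of functionals and is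
  the covariance of a linear image of independent standard normal variables. By uniqueness these Gaussian laws are
  consistent, and Kolmogorov's extension theorem yields the process (\<open>ex_centered_gaussian_process\<close>).
\<close>


section \<open>Trigonometric polynomials\<close>

text \<open>
  Real trigonometric polynomials with arbitrary real frequency vectors. An inductive definition over single
  waves \<open>Re (z e\<^sup>i\<^sup>\<langle>\<^sup>t\<^sup>,\<^sup>x\<^sup>\<rangle>)\<close> makes every statement that is linear in the function, in
  particular convergence of integrals, provable by checking one wave.
\<close>

inductive_set trig_polys :: "'i set \<Rightarrow> (('i \<Rightarrow> real) \<Rightarrow> real) set" for J where
  wave: "(\<lambda>x. Re (z * iexp (\<Sum>i\<in>J. t i * x i))) \<in> trig_polys J"
| add: "f \<in> trig_polys J \<Longrightarrow> g \<in> trig_polys J \<Longrightarrow> (\<lambda>x. f x + g x) \<in> trig_polys J"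

text \<open>
  The product-to-sum formula behind the closure of trigonometric polynomials under products: multiplying two
  waves adds and subtracts their frequencies.
\<close>

lemma Re_mult_Re: "Re a * Re b = Re (a * b / 2) + Re (a * cnj b / 2)"
  by (simp add: field_simps)

lemma trig_polys_mult:
  assumes "f \<in> trig_polys J" "g \<in> trig_polys J"
  shows "(\<lambda>x. f x * g x) \<in> trig_polys J"
  using assms(1)
proof induction
  case (wave z t)
  show ?case
    using assms(2)
  proof induction
    case (wave w s)
    have "(\<lambda>x. Re (z * iexp (\<Sum>i\<in>J. t i * x i)) * Re (w * iexp (\<Sum>i\<in>J. s i * x i))) =
      (\<lambda>x. Re ((z * w / 2) * iexp (\<Sum>i\<in>J. (t i + s i) * x i)) +
           Re ((z * cnj w / 2) * iexp (\<Sum>i\<in>J. (t i - s i) * x i)))"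
      unfolding Re_mult_Re
      by (intro ext arg_cong2[where f="(+)"] arg_cong[where f=Re])
        (simp_all add: sum.distrib sum_subtractf ring_distribs exp_add exp_diff exp_cnj exp_minus field_simps)
    then show ?case
      by (simp only: trig_polys.intros)
  next
    case (add f g)
    then show ?case
      by (simp add: distrib_left trig_polys.add)
  qed
next
  case (add f1 f2)
  then show ?case
    by (simp add: distrib_right trig_polys.add)
qed

lemma trig_polys_const: "(\<lambda>_. c) \<in> trig_polys J"
  using trig_polys.wave[of "complex_of_real c" "\<lambda>_. 0" J] by simp

lemma trig_polys_bounded: "f \<in> trig_polys J \<Longrightarrow> \<exists>B. \<forall>x. \<bar>f x\<bar> \<le> B"
proof (induction rule: trig_polys.induct)
  case (wave z t)
  have "\<bar>Re (z * iexp (\<Sum>i\<in>J. t i * x i))\<bar> \<le> cmod z" for x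
    using abs_Re_le_cmod[of "z * iexp (\<Sum>i\<in>J. t i * x i)"] by (simp add: norm_mult)
  then show ?case by blast
next
  case (add f g)
  then obtain B C where "\<And>x. \<bar>f x\<bar> \<le> B" "\<And>x. \<bar>g x\<bar> \<le> C" by blast
  then have "\<bar>f x + g x\<bar> \<le> B + C" for x
    by (meson abs_triangle_ineq add_mono order_trans)
  then show ?case by blast
qed

lemma trig_polys_continuous: "f \<in> trig_polys J \<Longrightarrow> continuous_on S f"
  by (induction rule: trig_polys.induct)
    (intro continuous_intros continuous_on_subset[OF continuous_on_product_coordinates]; simp)+

lemma trig_polys_measurable: "f \<in> trig_polys J \<Longrightarrow> f \<in> borel_measurable (PiM J (\<lambda>_. borel))"
  by (induction rule: trig_polys.induct) measurable

lemma trig_polys_polynomial: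
  assumes "real_polynomial_function P" "f \<in> trig_polys J"
  shows "(\<lambda>x. P (f x)) \<in> trig_polys J"
  using assms(1)
proof induction
  case (linear l)
  have "l (f x) = l 1 * f x" for x
    using linear_scale[OF bounded_linear.linear[OF linear], of "f x" 1] by (simp add: mult.commute)
  then show ?case
    using trig_polys_mult[OF trig_polys_const[of "l 1"] assms(2)] by simp
qed (auto intro: trig_polys_const trig_polys.add trig_polys_mult)

text \<open>
  The Stone-Weierstrass theorem gives a close trigonometric polynomial on the cube, but with no control
  outside of it. Composing it with a polynomial that is uniformly close to the truncation at \<open>\<plusminus>B\<close> stays inside
  the algebra and yields a global bound, which is what makes the mass outside the cube harmless.
\<close>

lemma trig_polys_approx:
  fixes h :: "(nat \<Rightarrow> real) \<Rightarrow> real"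
  assumes "finite J" and h: "continuous_on (PiE J (\<lambda>_. {-L..L})) h"
    and hB: "\<And>x. x \<in> PiE J (\<lambda>_. {-L..L}) \<Longrightarrow> \<bar>h x\<bar> \<le> B" and "B \<ge> 0" "e > 0"
  obtains p where "p \<in> trig_polys J" "\<And>x. x \<in> PiE J (\<lambda>_. {-L..L}) \<Longrightarrow> \<bar>p x - h x\<bar> < e"
    "\<And>x. \<bar>p x\<bar> \<le> B + e"
proof -
  define K where "K = PiE J (\<lambda>_. {-L..L})"
  have K_UNIV: "K = PiE UNIV (\<lambda>i. if i \<in> J then {-L..L} else {undefined})"
    unfolding K_def PiE_def Pi_def extensional_def by (auto split: if_splits)
  have "compact K"
  proof -
    have "compactin (product_topology (\<lambda>_::nat. euclideanreal) UNIV) K"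
      unfolding K_UNIV by (subst compactin_PiE) auto
    then show ?thesis
      by (simp add: euclidean_product_topology)
  qed
  have sep: "\<exists>f\<in>trig_polys J. f x \<noteq> f y" if xy: "x \<in> K" "y \<in> K" "x \<noteq> y" for x y
  proof -
    obtain i where i: "i \<in> J" "x i \<noteq> y i"
      using PiE_ext[OF xy(1,2)[unfolded K_def]] xy(3) by blast
    \<comment> \<open>Rescaled so that the phases at \<open>x\<close> and \<open>y\<close> differ by exactly \<open>1\<close>.\<close>
    define s where "s = 1 / (x i - y i)"
    define f where "f = (\<lambda>u. Re (iexp (- s * y i) * iexp (\<Sum>j\<in>J. (if j = i then s else 0) * u j)))"
    have sum: "(\<Sum>j\<in>J. (if j = i then s else 0) * u j) = s * u i" for u
    proof -
      have "(\<Sum>j\<in>J. (if j = i then s else 0) * u j) = (\<Sum>j\<in>J. if j = i then s * u j else 0)"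
        by (intro sum.cong) auto
      then show ?thesis
        using i \<open>finite J\<close> by simp
    qed
    have "f u = cos (s * (u i - y i))" for u
      unfolding f_def sum by (simp add: exp_add[symmetric] Re_exp algebra_simps flip: of_real_mult)
    then have "f x = cos 1" "f y = 1"
      using i by (simp_all add: s_def)
    moreover have "cos 1 < (cos 0 :: real)"
      by (rule cos_monotone_0_pi) (use pi_gt3 in auto)
    moreover have "f \<in> trig_polys J"
      unfolding f_def by (rule trig_polys.wave)
    ultimately show ?thesis
      by (intro bexI[of _ f]) auto
  qed
  interpret function_ring_on "trig_polys J" K
    by unfold_locales
      (use \<open>compact K\<close> sep in \<open>auto intro: trig_polys.add trig_polys_mult trig_polys_const trig_polys_continuous\<close>)
  obtain g where g: "g \<in> trig_polys J" "\<And>x. x \<in> K \<Longrightarrow> \<bar>h x - g x\<bar> < e/2"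
    using Stone_Weierstrass_basic[of h "e/2"] h \<open>e > 0\<close> unfolding K_def by auto
  obtain C where C: "\<And>x. \<bar>g x\<bar> \<le> C"
    using trig_polys_bounded[OF g(1)] by blast
  \<comment> \<open>Truncation does not increase the distance to \<open>h\<close>, whose values lie between \<open>-B\<close> and \<open>B\<close>.\<close>
  define clip where "clip u = max (-B) (min B u)" for u :: real
  have "continuous_on {-C..C} clip"
    unfolding clip_def by (intro continuous_intros)
  then obtain P where P: "real_polynomial_function P" "\<And>u. u \<in> {-C..C} \<Longrightarrow> \<bar>clip u - P u\<bar> < e/2"
    using Stone_Weierstrass_real_polynomial_function[of "{-C..C}" clip "e/2"] \<open>e > 0\<close> by auto
  have Pg: "\<bar>clip (g x) - P (g x)\<bar> < e/2" for x
    by (rule P(2)) (use C[of x] in auto)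
  show ?thesis
  proof
    show "(\<lambda>x. P (g x)) \<in> trig_polys J"
      by (rule trig_polys_polynomial[OF P(1) g(1)])
    show "\<bar>P (g x) - h x\<bar> < e" if "x \<in> PiE J (\<lambda>_. {-L..L})" for x
    proof -
      have "\<bar>clip (g x) - h x\<bar> \<le> \<bar>g x - h x\<bar>"
        using hB[OF that] unfolding clip_def by (auto simp: max_def min_def)
      then show ?thesis
        using Pg[of x] g(2)[of x] that unfolding K_def by (simp add: abs_real_def split: if_splits)
    qed
    show "\<bar>P (g x)\<bar> \<le> B + e" for x
    proof -
      have "\<bar>clip (g x)\<bar> \<le> B"
        using \<open>B \<ge> 0\<close> unfolding clip_def by auto
      then show ?thesis
        using Pg[of x] \<open>e > 0\<close> by linarith
    qed
  qed
qed


section \<open>Weak convergence from characteristic functions\<close>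

text \<open>
  A continuous substitute for the indicator of \<open>\<bar>u\<bar> > L\<close>, so that tails can be controlled by
  weak convergence.
\<close>

definition excess :: "real \<Rightarrow> real \<Rightarrow> real" where
  "excess L u = min 1 (max 0 (\<bar>u\<bar> - L))"

lemma excess_bounds: "0 \<le> excess L u" "excess L u \<le> 1" "\<bar>excess L u\<bar> \<le> 1"
  by (auto simp: excess_def)

lemma excess_eq_1: "\<bar>u\<bar> \<ge> L + 1 \<Longrightarrow> excess L u = 1"
  by (auto simp: excess_def)

lemma excess_measurable[measurable]: "excess L \<in> borel_measurable borel"
  unfolding excess_def[abs_def] by measurable

text \<open>
  Tightness of a single coordinate: the tail integral of the limit is small for large \<open>L\<close>, and Levy's
  continuity theorem on the line carries this over to all late members of the sequence.
\<close>

lemma tendsto_prob_excess: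
  fixes \<mu> :: "nat \<Rightarrow> real measure"
  assumes \<mu>: "\<And>n. real_distribution (\<mu> n)" and \<nu>: "real_distribution \<nu>"
    and char: "\<And>t. (\<lambda>n. char (\<mu> n) t) \<longlonglongrightarrow> char \<nu> t" and "d > 0"
  obtains L where "(LINT u|\<nu>. excess L u) < d" "eventually (\<lambda>n. (LINT u|\<mu> n. excess L u) < d) sequentially"
proof -
  interpret \<nu>: real_distribution \<nu> by fact
  have "(\<lambda>k. LINT u|\<nu>. excess (real k) u) \<longlonglongrightarrow> (LINT u|\<nu>. 0)"
  proof (rule integral_dominated_convergence[where w="\<lambda>_. 1"])
    have "(\<lambda>k. excess (real k) u) \<longlonglongrightarrow> 0" for u
    proof (rule tendsto_eventually)
      obtain k0 :: nat where "\<bar>u\<bar> \<le> real k0" using real_arch_simple by blast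
      then show "eventually (\<lambda>k. excess (real k) u = 0) sequentially"
        by (intro eventually_sequentiallyI[of k0]) (auto simp: excess_def)
    qed
    then show "AE u in \<nu>. (\<lambda>k. excess (real k) u) \<longlonglongrightarrow> 0" by simp
  qed (auto simp: excess_bounds)
  then have "(\<lambda>k. LINT u|\<nu>. excess (real k) u) \<longlonglongrightarrow> 0" by simp
  from order_tendstoD(2)[OF this \<open>d > 0\<close>]
  obtain k where k: "(LINT u|\<nu>. excess (real k) u) < d"
    by (auto dest: eventually_happens simp: eventually_sequentially)
  have "weak_conv_m \<mu> \<nu>"
    by (rule levy_continuity[OF \<mu> \<nu> char])
  then have "(\<lambda>n. LINT u|\<mu> n. excess (real k) u) \<longlonglongrightarrow> (LINT u|\<nu>. excess (real k) u)"
  proof (rule weak_conv_imp_integral_bdd_continuous_conv[OF \<mu> \<nu>])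
    show "isCont (excess (real k)) u" for u
      unfolding excess_def[abs_def] by (intro continuous_intros)
    show "norm (excess (real k) u) \<le> 1" for u
      using excess_bounds by simp
  qed
  from order_tendstoD(2)[OF this k] k show ?thesis
    by (rule that[rotated])
qed

abbreviation char_fun :: "'i set \<Rightarrow> ('i \<Rightarrow> real) measure \<Rightarrow> ('i \<Rightarrow> real) \<Rightarrow> complex" where
  "char_fun J \<mu> t \<equiv> (CLINT x|\<mu>. iexp (\<Sum>i\<in>J. t i * x i))"

lemma integrable_trig_polys:
  assumes "prob_space \<mu>" "sets \<mu> = sets (PiM J (\<lambda>_. borel))" "p \<in> trig_polys J"
  shows "integrable \<mu> p"
proof -
  interpret prob_space \<mu> by fact
  obtain B where "\<And>x. \<bar>p x\<bar> \<le> B" using trig_polys_bounded[OF assms(3)] by blast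
  moreover have "p \<in> borel_measurable \<mu>"
    using trig_polys_measurable[OF assms(3)] measurable_cong_sets[OF assms(2) refl] by blast
  ultimately show ?thesis
    by (intro integrable_const_bound[of _ B]) auto
qed

lemma tendsto_integral_trig_polys:
  assumes \<mu>: "\<And>n::nat. prob_space (\<mu> n)" "\<And>n. sets (\<mu> n) = sets (PiM J (\<lambda>_. borel))"
    and \<nu>: "prob_space \<nu>" "sets \<nu> = sets (PiM J (\<lambda>_. borel))"
    and char: "\<And>t. (\<lambda>n. char_fun J (\<mu> n) t) \<longlonglongrightarrow> char_fun J \<nu> t"
    and p: "p \<in> trig_polys J"
  shows "(\<lambda>n. LINT x|\<mu> n. p x) \<longlonglongrightarrow> (LINT x|\<nu>. p x)"
  using p
proof induction
  case (wave z t)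
  have *: "(LINT x|M. Re (z * iexp (\<Sum>i\<in>J. t i * x i))) = Re (z * char_fun J M t)"
    if "prob_space M" "sets M = sets (PiM J (\<lambda>_. borel))" for M
  proof -
    interpret prob_space M by fact
    have [measurable_cong]: "sets M = sets (PiM J (\<lambda>_. borel))" by fact
    have "integrable M (\<lambda>x. z * iexp (\<Sum>i\<in>J. t i * x i))"
      by (intro integrable_const_bound[of _ "cmod z"]) (auto simp: norm_mult simp del: of_real_sum)
    then have "(LINT x|M. Re (z * iexp (\<Sum>i\<in>J. t i * x i))) = Re (CLINT x|M. z * iexp (\<Sum>i\<in>J. t i * x i))"
      by (rule integral_Re)
    then show ?thesis
      by simp
  qed
  show ?case
    unfolding *[OF \<mu>] *[OF \<nu>] by (intro tendsto_intros char)
next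
  case (add f g)
  then show ?case
    using integrable_trig_polys[OF \<mu>] integrable_trig_polys[OF \<nu>] by (simp add: tendsto_add)
qed

text \<open>
  Points of the product over \<open>J\<close> are functions on all naturals that are \<open>undefined\<close> off
  \<open>J\<close>; this embeds the product into the full sequence space.
\<close>

lemma borel_measurable_extensional:
  assumes "sets M = sets (PiM J (\<lambda>_. borel :: real measure))"
  shows "(\<lambda>x :: nat \<Rightarrow> real. x) \<in> borel_measurable M"
proof (rule measurable_coordinatewise_then_product)
  fix i
  have "(\<lambda>x. x i) \<in> borel_measurable (PiM J (\<lambda>_. borel :: real measure))"
  proof (cases "i \<in> J")
    case False
    then have "(\<lambda>x. x i) \<in> borel_measurable (PiM J (\<lambda>_. borel :: real measure)) \<longleftrightarrow>
      (\<lambda>_. undefined :: real) \<in> borel_measurable (PiM J (\<lambda>_. borel :: real measure))"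
      by (intro measurable_cong) (auto simp: space_PiM PiE_def extensional_def)
    then show ?thesis by simp
  qed simp
  then show "(\<lambda>x. x i) \<in> borel_measurable M"
    by (simp add: measurable_cong_sets[OF assms refl])
qed

text \<open>
  Levy's continuity theorem in several dimensions, in the case where the limit is already known to be a
  probability measure. The class of functions whose integrals converge contains all trigonometric polynomials. By
  \<open>trig_polys_approx\<close> a bounded continuous \<open>h\<close> is within \<open>e\<close> of one of these on a large cube and both are
  bounded by about \<open>B\<close> outside, where the tails of the coordinates leave little mass. Over the naturals
  the Borel sets of the full function space are the product sets, so that continuous functions are measurable.
\<close>

lemma tendsto_char_fun_imp_tendsto_integral:
  fixes \<mu> :: "nat \<Rightarrow> (nat \<Rightarrow> real) measure"
  assumes J: "finite J"
    and \<mu>: "\<And>n. prob_space (\<mu> n)" "\<And>n. sets (\<mu> n) = sets (PiM J (\<lambda>_. borel))"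
    and \<nu>: "prob_space \<nu>" "sets \<nu> = sets (PiM J (\<lambda>_. borel))"
    and char: "\<And>t. (\<lambda>n. char_fun J (\<mu> n) t) \<longlonglongrightarrow> char_fun J \<nu> t"
    and h: "continuous_map (product_topology (\<lambda>_. euclideanreal) J) euclideanreal h"
    and hB: "\<And>x. x \<in> extensional J \<Longrightarrow> \<bar>h x\<bar> \<le> B"
  shows "(\<lambda>n. LINT x|\<mu> n. h x) \<longlonglongrightarrow> (LINT x|\<nu>. h x)"
proof -
  have "B \<ge> 0"
    using hB[of "\<lambda>_. undefined"] by (auto simp: extensional_def)
  \<comment> \<open>A continuous extension of \<open>h\<close> to all functions, where continuity is that of the type class.\<close>
  define h' where "h' x = h (restrict x J)" for x
  have "continuous_map (product_topology (\<lambda>_::nat. euclideanreal) UNIV) (product_topology (\<lambda>_. euclideanreal) J) (\<lambda>x. restrict x J)"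
    unfolding continuous_map_componentwise by (auto intro!: continuous_map_product_coordinates simp del: euclidean_product_topology)
  from continuous_map_compose[OF this h] have h'_cont: "continuous_on UNIV h'"
    unfolding h'_def[abs_def] by (simp add: euclidean_product_topology comp_def)
  have h'_eq: "h' x = h x" if "x \<in> extensional J" for x
    using that by (simp add: h'_def extensional_restrict)
  have h'B: "\<bar>h' x\<bar> \<le> B" for x
    unfolding h'_def by (rule hB) simp
  have h_meas: "h \<in> borel_measurable (PiM J (\<lambda>_. borel))"
  proof -
    have "h' \<in> borel_measurable (PiM J (\<lambda>_. borel))"
      using measurable_compose[OF borel_measurable_extensional[OF refl] borel_measurable_continuous_onI[OF h'_cont]]
      by (simp add: comp_def)
    then show ?thesis
      by (rule measurable_cong[THEN iffD1, rotated]) (auto simp: h'_eq space_PiM PiE_def)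
  qed
  have tail: "\<exists>L. (LINT x|\<nu>. excess L (x i)) < d \<and> eventually (\<lambda>n. (LINT x|\<mu> n. excess L (x i)) < d) sequentially"
    if i: "i \<in> J" and "d > 0" for i d
  proof -
    have sum: "(\<Sum>j\<in>J. (if j = i then s else 0) * x j) = s * x i" for s and x :: "nat \<Rightarrow> real"
    proof -
      have "(\<Sum>j\<in>J. (if j = i then s else 0) * x j) = (\<Sum>j\<in>J. if j = i then s * x j else 0)"
        by (intro sum.cong) auto
      then show ?thesis
        using i J by simp
    qed
    have meas: "(\<lambda>x. x i) \<in> borel_measurable M" if "sets M = sets (PiM J (\<lambda>_. borel))" for M :: "(nat \<Rightarrow> real) measure"
      using i measurable_cong_sets[OF that refl] by (metis measurable_component_singleton)
    have ch: "char (distr M borel (\<lambda>x. x i)) s = char_fun J M (\<lambda>j. if j = i then s else 0)"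
      if "sets M = sets (PiM J (\<lambda>_. borel))" for M s
      unfolding char_def using meas[OF that] by (subst integral_distr) (simp_all only: sum, simp_all)
    have rd: "real_distribution (distr M borel (\<lambda>x. x i))"
      if "prob_space M" "sets M = sets (PiM J (\<lambda>_. borel))" for M
      using that meas by (simp add: prob_space.real_distribution_distr)
    have eq: "(LINT u|distr M borel (\<lambda>x. x i). excess L u) = (LINT x|M. excess L (x i))"
      if "sets M = sets (PiM J (\<lambda>_. borel))" for M L
      using meas[OF that] by (subst integral_distr) auto
    obtain L where "(LINT u|distr \<nu> borel (\<lambda>x. x i). excess L u) < d"
      "eventually (\<lambda>n. (LINT u|distr (\<mu> n) borel (\<lambda>x. x i). excess L u) < d) sequentially"
      by (rule tendsto_prob_excess[where \<mu>="\<lambda>n. distr (\<mu> n) borel (\<lambda>x. x i)" and \<nu>="distr \<nu> borel (\<lambda>x. x i)" and d=d])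
        (use rd \<mu> \<nu> ch char \<open>d > 0\<close> in auto)
    then show ?thesis
      using eq \<mu>(2) \<nu>(2) by auto
  qed
  show ?thesis
  proof (rule LIMSEQ_I)
    fix r :: real assume "r > 0"
    define N where "N = real (card J)"
    \<comment> \<open>Two errors of size \<open>2 * e\<close> arise from replacing \<open>h\<close> by \<open>p\<close>, one of size \<open>e\<close> from the convergence for
      \<open>p\<close>; \<open>d\<close> is so small that the tails of all coordinates together contribute at most \<open>e\<close>.\<close>
    define e where "e = r / 5"
    define d where "d = e / ((2 * B + e) * N + 1)"
    have "N \<ge> 0" "e > 0" unfolding N_def e_def using \<open>r > 0\<close> by auto
    then have den: "(2 * B + e) * N + 1 > 0" using \<open>B \<ge> 0\<close> by (simp add: add_nonneg_pos)
    then have "d > 0" unfolding d_def using \<open>e > 0\<close> by simp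
    have d: "(2 * B + e) * (N * d) \<le> e"
    proof -
      have "(2 * B + e) * (N * d) = e * (((2 * B + e) * N) / ((2 * B + e) * N + 1))"
        by (simp add: d_def)
      also have "\<dots> \<le> e * 1"
        using den \<open>e > 0\<close> by (intro mult_left_mono) (auto simp: divide_le_eq)
      finally show ?thesis by simp
    qed
    obtain L where L: "\<And>i. i \<in> J \<Longrightarrow> (LINT x|\<nu>. excess (L i) (x i)) < d"
      "\<And>i. i \<in> J \<Longrightarrow> eventually (\<lambda>n. (LINT x|\<mu> n. excess (L i) (x i)) < d) sequentially"
      using tail[OF _ \<open>d > 0\<close>] by metis
    define R where "R = (\<Sum>i\<in>J. \<bar>L i\<bar> + 1)"
    have R: "L i + 1 \<le> R" if "i \<in> J" for i
    proof -
      have "L i + 1 \<le> \<bar>L i\<bar> + 1" by simp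
      also have "\<dots> \<le> R" unfolding R_def
        using that J by (intro member_le_sum) auto
      finally show ?thesis .
    qed
    obtain p where p: "p \<in> trig_polys J" "\<And>x. x \<in> PiE J (\<lambda>_. {-R..R}) \<Longrightarrow> \<bar>p x - h' x\<bar> < e"
      "\<And>x. \<bar>p x\<bar> \<le> B + e"
      by (rule trig_polys_approx[of J R h' B e])
        (use J continuous_on_subset[OF h'_cont] h'B \<open>B \<ge> 0\<close> \<open>e > 0\<close> in auto)
    have close: "\<bar>(LINT x|M. h x) - (LINT x|M. p x)\<bar> \<le> 2 * e"
      if M: "prob_space M" "sets M = sets (PiM J (\<lambda>_. borel))"
        and Md: "\<And>i. i \<in> J \<Longrightarrow> (LINT x|M. excess (L i) (x i)) < d" for M
    proof -
      interpret prob_space M by fact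
      have sp: "space M = extensional J"
        using sets_eq_imp_space_eq[OF M(2)] by (simp add: space_PiM PiE_def)
      have hm: "h \<in> borel_measurable M"
        using h_meas measurable_cong_sets[OF M(2) refl] by blast
      have "integrable M h"
        by (rule integrable_const_bound[of _ B]) (use hm hB sp in auto)
      have ip: "integrable M p"
        by (rule integrable_trig_polys[OF M p(1)])
      have em: "(\<lambda>x. excess (L i) (x i)) \<in> borel_measurable M" if "i \<in> J" for i
      proof -
        have "(\<lambda>x. x i) \<in> borel_measurable M"
          using that measurable_cong_sets[OF M(2) refl] by (metis measurable_component_singleton)
        then show ?thesis by measurable
      qed
      have ie: "integrable M (\<lambda>x. excess (L i) (x i))" if "i \<in> J" for i
        by (rule integrable_const_bound[of _ 1]) (use em that excess_bounds in auto)
      \<comment> \<open>Outside the cube some coordinate exceeds its level by \<open>1\<close>, so that its excess equals \<open>1\<close>.\<close>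
      have pt: "\<bar>h x - p x\<bar> \<le> e + (2 * B + e) * (\<Sum>i\<in>J. excess (L i) (x i))" if "x \<in> space M" for x
      proof (cases "x \<in> PiE J (\<lambda>_. {-R..R})")
        case True
        have "\<bar>h x - p x\<bar> \<le> e"
          using p(2)[OF True] h'_eq that sp by (simp add: abs_minus_commute less_imp_le)
        moreover have "0 \<le> (2 * B + e) * (\<Sum>i\<in>J. excess (L i) (x i))"
          using \<open>B \<ge> 0\<close> \<open>e > 0\<close> by (intro mult_nonneg_nonneg sum_nonneg excess_bounds) auto
        ultimately show ?thesis by linarith
      next
        case False
        then have "\<not> (\<forall>i\<in>J. x i \<in> {-R..R})"
          using that sp by (simp add: PiE_iff)
        then obtain i where i: "i \<in> J" "x i \<notin> {-R..R}"
          by blast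
        then have "excess (L i) (x i) = 1"
          using R[of i] by (intro excess_eq_1) auto
        then have "1 \<le> (\<Sum>i\<in>J. excess (L i) (x i))"
          using member_le_sum[of i J "\<lambda>i. excess (L i) (x i)"] i J excess_bounds by auto
        then have "2 * B + e \<le> (2 * B + e) * (\<Sum>i\<in>J. excess (L i) (x i))"
          using \<open>B \<ge> 0\<close> \<open>e > 0\<close> by (auto simp: mult_le_cancel_left1)
        moreover have "\<bar>h x - p x\<bar> \<le> 2 * B + e"
          using hB[of x] p(3)[of x] that sp by auto
        ultimately show ?thesis using \<open>e > 0\<close> by linarith
      qed
      have "\<bar>(LINT x|M. h x) - (LINT x|M. p x)\<bar> = \<bar>LINT x|M. h x - p x\<bar>"
        using \<open>integrable M h\<close> ip by simp
      also have "\<dots> \<le> (LINT x|M. \<bar>h x - p x\<bar>)"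
        by (rule integral_abs_bound)
      also have "\<dots> \<le> (LINT x|M. e + (2 * B + e) * (\<Sum>i\<in>J. excess (L i) (x i)))"
        by (rule integral_mono) (use \<open>integrable M h\<close> ip ie pt in auto)
      also have "\<dots> = e + (2 * B + e) * (\<Sum>i\<in>J. LINT x|M. excess (L i) (x i))"
        using ie by (simp add: prob_space)
      also have "\<dots> \<le> e + (2 * B + e) * (\<Sum>i\<in>J. d)"
        using Md \<open>B \<ge> 0\<close> \<open>e > 0\<close> by (intro add_left_mono mult_left_mono sum_mono) (auto intro: less_imp_le)
      also have "\<dots> \<le> 2 * e"
        using d by (simp add: N_def)
      finally show ?thesis .
    qed
    have "eventually (\<lambda>n. \<forall>i\<in>J. (LINT x|\<mu> n. excess (L i) (x i)) < d) sequentially"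
      using L(2) J by (simp add: eventually_ball_finite_distrib)
    moreover have "eventually (\<lambda>n. norm ((LINT x|\<mu> n. p x) - (LINT x|\<nu>. p x)) < e) sequentially"
      using tendsto_integral_trig_polys[OF \<mu> \<nu> char p(1)] \<open>e > 0\<close>
      by (simp add: tendsto_iff dist_norm)
    ultimately have "eventually (\<lambda>n. norm ((LINT x|\<mu> n. h x) - (LINT x|\<nu>. h x)) < r) sequentially"
    proof eventually_elim
      case (elim n)
      have "\<bar>(LINT x|\<mu> n. h x) - (LINT x|\<mu> n. p x)\<bar> \<le> 2 * e"
        using close[OF \<mu>] elim by blast
      moreover have "\<bar>(LINT x|\<nu>. h x) - (LINT x|\<nu>. p x)\<bar> \<le> 2 * e"
        using close[OF \<nu>] L by blast
      moreover have "r = 5 * e"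
        by (simp add: e_def)
      ultimately show ?case
        using elim by (simp add: abs_real_def split: if_splits)
    qed
    then show "\<exists>no. \<forall>n\<ge>no. norm ((LINT x|\<mu> n. h x) - (LINT x|\<nu>. h x)) < r"
      by (simp add: eventually_sequentially)
  qed
qed


section \<open>Uniqueness of finite-dimensional laws\<close>

text \<open>
  The indicator of a closed set \<open>C\<close> is the decreasing limit of the continuous functions
  \<open>max 0 (1 - k dist(x, C))\<close>, and closed sets form an intersection-stable generator.
\<close>

lemma measure_eqI_continuous_bounded:
  fixes \<mu> \<nu> :: "'a::metric_space measure"
  assumes \<mu>: "prob_space \<mu>" "sets \<mu> = sets borel" and \<nu>: "prob_space \<nu>" "sets \<nu> = sets borel"
    and eq: "\<And>h. continuous_on UNIV h \<Longrightarrow> (\<And>x. \<bar>h x\<bar> \<le> 1) \<Longrightarrow> (LINT x|\<mu>. h x) = (LINT x|\<nu>. h x :: real)"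
  shows "\<mu> = \<nu>"
proof -
  interpret \<mu>: prob_space \<mu> by fact
  interpret \<nu>: prob_space \<nu> by fact
  have [measurable_cong]: "sets \<mu> = sets borel" "sets \<nu> = sets borel" by fact+
  have [simp]: "space \<mu> = UNIV" "space \<nu> = UNIV"
    using sets_eq_imp_space_eq[OF \<mu>(2)] sets_eq_imp_space_eq[OF \<nu>(2)] by simp_all
  have closed_eq: "emeasure \<mu> C = emeasure \<nu> C" if "closed C" for C
  proof (cases "C = {}")
    case False
    define h where "h k x = max 0 (1 - real k * infdist x C)" for k x
    have h_cont: "continuous_on UNIV (h k)" for k
      unfolding h_def[abs_def] by (intro continuous_intros)
    have h_bd: "\<bar>h k x\<bar> \<le> 1" for k x
      unfolding h_def using infdist_nonneg[of x C] by (auto simp: max_def)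
    have [measurable]: "h k \<in> borel_measurable borel" for k
      by (intro borel_measurable_continuous_onI h_cont)
    have [measurable]: "C \<in> sets borel"
      using that by simp
    have lim: "(\<lambda>k. h k x) \<longlonglongrightarrow> indicator C x" for x
    proof (cases "x \<in> C")
      case True
      then show ?thesis by (simp add: h_def)
    next
      case False
      then have "infdist x C > 0"
        using in_closed_iff_infdist_zero[OF that \<open>C \<noteq> {}\<close>, of x] infdist_nonneg[of x C] by auto
      obtain k0 where k0: "1 < real k0 * infdist x C"
        using reals_Archimedean3[OF \<open>infdist x C > 0\<close>] by blast
      have "eventually (\<lambda>k. h k x = indicator C x) sequentially"
      proof (rule eventually_sequentiallyI[of k0])
        fix k assume "k0 \<le> k"
        then have "real k0 * infdist x C \<le> real k * infdist x C"
          by (intro mult_right_mono infdist_nonneg) auto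
        then show "h k x = indicator C x"
          using k0 False by (simp add: h_def)
      qed
      then show ?thesis by (rule tendsto_eventually)
    qed
    have "(\<lambda>k. LINT x|\<mu>. h k x) \<longlonglongrightarrow> (LINT x|\<mu>. indicator C x)"
      by (rule integral_dominated_convergence[where w="\<lambda>_. 1"]) (use lim h_bd in auto)
    moreover have "(\<lambda>k. LINT x|\<nu>. h k x) \<longlonglongrightarrow> (LINT x|\<nu>. indicator C x)"
      by (rule integral_dominated_convergence[where w="\<lambda>_. 1"]) (use lim h_bd in auto)
    ultimately have "measure \<mu> C = measure \<nu> C"
      using eq[OF h_cont h_bd] LIMSEQ_unique by fastforce
    then show ?thesis
      by (simp add: \<mu>.emeasure_eq_measure \<nu>.emeasure_eq_measure)
  qed simp
  show ?thesis
  proof (rule measure_eqI_generator_eq[where \<Omega>=UNIV and E="Collect closed" and A="\<lambda>_. UNIV"])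
    show "sets \<mu> = sigma_sets UNIV (Collect closed)" "sets \<nu> = sigma_sets UNIV (Collect closed)"
      using \<mu>(2) \<nu>(2) by (simp_all add: borel_eq_closed)
  qed (use closed_eq in \<open>auto simp: Int_stable_def\<close>)
qed

text \<open>
  A constant sequence with the characteristic functions of \<open>\<nu>\<close> converges to \<open>\<nu>\<close>, so uniqueness
  is a case of the continuity theorem.
\<close>

lemma measure_eqI_char_fun_nat:
  fixes \<mu> \<nu> :: "(nat \<Rightarrow> real) measure"
  assumes J: "finite J"
    and \<mu>: "prob_space \<mu>" "sets \<mu> = sets (PiM J (\<lambda>_. borel))"
    and \<nu>: "prob_space \<nu>" "sets \<nu> = sets (PiM J (\<lambda>_. borel))"
    and char: "\<And>t. char_fun J \<mu> t = char_fun J \<nu> t"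
  shows "\<mu> = \<nu>"
proof -
  interpret \<mu>: prob_space \<mu> by fact
  interpret \<nu>: prob_space \<nu> by fact
  have id_cont: "continuous_map (product_topology (\<lambda>_. euclideanreal) J) euclidean (\<lambda>x::nat \<Rightarrow> real. x)"
    unfolding euclidean_product_topology[symmetric] continuous_map_componentwise_UNIV
  proof
    fix k
    show "continuous_map (product_topology (\<lambda>_. euclideanreal) J) euclideanreal (\<lambda>x. x k)"
    proof (cases "k \<in> J")
      case False
      then have "continuous_map (product_topology (\<lambda>_. euclideanreal) J) euclideanreal (\<lambda>x. x k) \<longleftrightarrow>
        continuous_map (product_topology (\<lambda>_. euclideanreal) J) euclideanreal (\<lambda>_. undefined)"
        by (intro iffI; elim continuous_map_eq) (auto simp: PiE_def extensional_def)
      then show ?thesis by simp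
    qed (rule continuous_map_product_projection)
  qed
  note id_\<mu> = borel_measurable_extensional[OF \<mu>(2)]
  note id_\<nu> = borel_measurable_extensional[OF \<nu>(2)]
  have "distr \<mu> borel (\<lambda>x. x) = distr \<nu> borel (\<lambda>x. x)"
  proof (rule measure_eqI_continuous_bounded)
    fix h :: "(nat \<Rightarrow> real) \<Rightarrow> real"
    assume h: "continuous_on UNIV h" "\<And>x. \<bar>h x\<bar> \<le> 1"
    have "continuous_map (product_topology (\<lambda>_. euclideanreal) J) euclideanreal h"
      using continuous_map_compose[OF id_cont, of euclideanreal h] h(1) by (simp add: comp_def)
    then have "(\<lambda>_::nat. LINT x|\<mu>. h x) \<longlonglongrightarrow> (LINT x|\<nu>. h x)"
      by (rule tendsto_char_fun_imp_tendsto_integral[OF J \<mu> \<nu>, where B=1, rotated]) (simp_all only: char h tendsto_const)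
    then have "(LINT x|\<mu>. h x) = (LINT x|\<nu>. h x)"
      by (simp add: LIMSEQ_const_iff)
    then show "(LINT x|distr \<mu> borel (\<lambda>x. x). h x) = (LINT x|distr \<nu> borel (\<lambda>x. x). h x)"
      using id_\<mu> id_\<nu> borel_measurable_continuous_onI[OF h(1)] by (simp add: integral_distr)
  qed (auto intro: \<mu>.prob_space_distr \<nu>.prob_space_distr id_\<mu> id_\<nu>)
  then have *: "distr (distr \<mu> borel (\<lambda>x. x)) (PiM J (\<lambda>_. borel)) (\<lambda>x. restrict x J) =
    distr (distr \<nu> borel (\<lambda>x. x)) (PiM J (\<lambda>_. borel)) (\<lambda>x. restrict x J)"
    by simp
  have restr: "(\<lambda>x. restrict x J) \<in> measurable borel (PiM J (\<lambda>_. borel :: real measure))"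
  proof (rule measurable_restrict)
    fix i assume "i \<in> J"
    show "(\<lambda>x. x i) \<in> borel_measurable borel"
      by (rule borel_measurable_continuous_onI) simp
  qed
  have "distr (distr \<kappa> borel (\<lambda>x. x)) (PiM J (\<lambda>_. borel)) (\<lambda>x. restrict x J) = \<kappa>"
    if "sets \<kappa> = sets (PiM J (\<lambda>_. borel))" for \<kappa> :: "(nat \<Rightarrow> real) measure"
  proof -
    have "space \<kappa> = extensional J"
      using sets_eq_imp_space_eq[OF that] by (simp add: space_PiM PiE_def)
    then have "distr \<kappa> (PiM J (\<lambda>_. borel)) (\<lambda>x. restrict x J) = distr \<kappa> \<kappa> (\<lambda>x. x)"
      using that by (intro distr_cong) (auto simp: extensional_restrict)
    then show ?thesis
      using distr_distr[OF restr borel_measurable_extensional[OF that]] by (simp add: comp_def distr_id2)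
  qed
  then show ?thesis
    using * \<mu>(2) \<nu>(2) by simp
qed

text \<open>
  Uniqueness for an arbitrary finite index set, obtained by numbering its elements.
\<close>

lemma measure_eqI_char_fun:
  fixes \<mu> \<nu> :: "('i \<Rightarrow> real) measure"
  assumes J: "finite J"
    and \<mu>: "prob_space \<mu>" "sets \<mu> = sets (PiM J (\<lambda>_. borel))"
    and \<nu>: "prob_space \<nu>" "sets \<nu> = sets (PiM J (\<lambda>_. borel))"
    and char: "\<And>t. char_fun J \<mu> t = char_fun J \<nu> t"
  shows "\<mu> = \<nu>"
proof -
  obtain e where e: "bij_betw e {..<card J} J"
    using ex_bij_betw_nat_finite[OF J] by (auto simp: atLeast0LessThan)
  let ?K = "{..<card J}"
  let ?PK = "PiM ?K (\<lambda>_. borel :: real measure)" and ?PJ = "PiM J (\<lambda>_. borel :: real measure)"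
  define e' where "e' = the_inv_into ?K e"
  have e': "e' i \<in> ?K" "e (e' i) = i" if "i \<in> J" for i
    using e that the_inv_into_into[of e ?K i ?K] f_the_inv_into_f[of e ?K i]
    by (auto simp: e'_def bij_betw_def)
  have ee: "e n \<in> J" if "n \<in> ?K" for n
    using e that by (auto simp: bij_betw_def)
  define \<phi> where "\<phi> x = (\<lambda>n\<in>?K. x (e n))" for x :: "'i \<Rightarrow> real"
  define \<psi> where "\<psi> y = (\<lambda>i\<in>J. y (e' i))" for y :: "nat \<Rightarrow> real"
  have \<phi>: "\<phi> \<in> measurable ?PJ ?PK"
    unfolding \<phi>_def[abs_def] by (intro measurable_restrict measurable_component_singleton ee)
  have \<psi>: "\<psi> \<in> measurable ?PK ?PJ"
    unfolding \<psi>_def[abs_def] by (intro measurable_restrict measurable_component_singleton e')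
  have inv: "distr (distr \<kappa> ?PK \<phi>) ?PJ \<psi> = \<kappa>" if \<kappa>: "sets \<kappa> = sets ?PJ" for \<kappa>
  proof -
    have sp: "space \<kappa> = extensional J"
      using sets_eq_imp_space_eq[OF \<kappa>] by (simp add: space_PiM PiE_def)
    have "\<phi> \<in> measurable \<kappa> ?PK"
      using \<phi> measurable_cong_sets[OF \<kappa> refl] by blast
    then have "distr (distr \<kappa> ?PK \<phi>) ?PJ \<psi> = distr \<kappa> ?PJ (\<psi> \<circ> \<phi>)"
      using \<psi> by (subst distr_distr) auto
    also have "\<dots> = distr \<kappa> \<kappa> (\<lambda>x. x)"
      using \<kappa> sp by (intro distr_cong) (auto simp: \<psi>_def \<phi>_def e'[simplified] extensional_def restrict_def fun_eq_iff)
    finally show ?thesis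
      by (simp add: distr_id2)
  qed
  have ch: "char_fun ?K (distr \<kappa> ?PK \<phi>) t = char_fun J \<kappa> (\<lambda>i. t (e' i))" if \<kappa>: "sets \<kappa> = sets ?PJ" for \<kappa> t
  proof -
    have [measurable]: "\<phi> \<in> measurable \<kappa> ?PK"
      using \<phi> measurable_cong_sets[OF \<kappa> refl] by blast
    have e'e: "e' (e n) = n" if "n \<in> ?K" for n
      using e that the_inv_into_f_f[of e ?K n] by (auto simp: e'_def bij_betw_def)
    have "(\<Sum>n<card J. t n * \<phi> x n) = (\<Sum>i\<in>J. t (e' i) * x i)" for x
    proof -
      have "(\<Sum>n<card J. t n * \<phi> x n) = (\<Sum>n<card J. t (e' (e n)) * x (e n))"
        by (intro sum.cong) (auto simp: e'e \<phi>_def)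
      also have "\<dots> = (\<Sum>i\<in>J. t (e' i) * x i)"
        by (rule sum.reindex_bij_betw[OF e])
      finally show ?thesis .
    qed
    moreover have "char_fun ?K (distr \<kappa> ?PK \<phi>) t = (CLINT x|\<kappa>. iexp (\<Sum>n<card J. t n * \<phi> x n))"
      by (rule integral_distr) measurable
    ultimately show ?thesis
      by (simp only:)
  qed
  have "distr \<mu> ?PK \<phi> = distr \<nu> ?PK \<phi>"
  proof (rule measure_eqI_char_fun_nat[of ?K])
    show "prob_space (distr \<mu> ?PK \<phi>)" "prob_space (distr \<nu> ?PK \<phi>)"
      using \<phi> measurable_cong_sets[OF \<mu>(2) refl] measurable_cong_sets[OF \<nu>(2) refl] 
      by (auto intro!: prob_space.prob_space_distr \<mu>(1) \<nu>(1))
  qed (use ch \<mu> \<nu> char in auto)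
  then show ?thesis
    using inv[OF \<mu>(2)] inv[OF \<nu>(2)] by metis
qed


section \<open>Finite-dimensional Gaussian laws\<close>

definition quad_form :: "'i set \<Rightarrow> ('i \<Rightarrow> 'i \<Rightarrow> real) \<Rightarrow> ('i \<Rightarrow> real) \<Rightarrow> real" where
  "quad_form J c a = (\<Sum>i\<in>J. \<Sum>j\<in>J. a i * a j * c i j)"

definition covariance_kernel :: "'i set \<Rightarrow> ('i \<Rightarrow> 'i \<Rightarrow> real) \<Rightarrow> bool" where
  "covariance_kernel I c \<longleftrightarrow> (\<forall>i\<in>I. \<forall>j\<in>I. c i j = c j i) \<and>
     (\<forall>J a. finite J \<and> J \<subseteq> I \<longrightarrow> 0 \<le> quad_form J c a)"

lemma covariance_kernel_sym: "covariance_kernel I c \<Longrightarrow> i \<in> I \<Longrightarrow> j \<in> I \<Longrightarrow> c i j = c j i"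
  by (simp add: covariance_kernel_def)

lemma covariance_kernel_nonneg:
  "covariance_kernel I c \<Longrightarrow> finite J \<Longrightarrow> J \<subseteq> I \<Longrightarrow> 0 \<le> quad_form J c a"
  by (simp add: covariance_kernel_def)

lemma quad_form_cong:
  "(\<And>i. i \<in> J \<Longrightarrow> a i = b i) \<Longrightarrow> quad_form J c a = quad_form J c b"
  unfolding quad_form_def by (intro sum.cong) auto

lemma quad_form_scale: "quad_form J c (\<lambda>i. s * a i) = s\<^sup>2 * quad_form J c a"
  unfolding quad_form_def sum_distrib_left by (intro sum.cong) (auto simp: power2_eq_square)

lemma quad_form_insert:
  assumes "finite J" "x \<notin> J" "\<And>j. j \<in> J \<Longrightarrow> c j x = c x j"
  shows "quad_form (insert x J) c a =
    (a x)\<^sup>2 * c x x + 2 * a x * (\<Sum>j\<in>J. a j * c x j) + quad_form J c a"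
  using assms
  by (simp add: quad_form_def sum.distrib sum_distrib_left power2_eq_square mult_ac)

lemma quad_form_extend_0:
  assumes "J \<subseteq> H" "finite H"
  shows "quad_form H c (\<lambda>i. if i \<in> J then a i else 0) = quad_form J c a"
proof -
  have "quad_form H c (\<lambda>i. if i \<in> J then a i else 0) =
    (\<Sum>i\<in>J. \<Sum>j\<in>H. (if j \<in> J then a i * a j * c i j else 0))"
    unfolding quad_form_def using assms
    by (intro sum.mono_neutral_cong_right) (auto intro!: sum.cong)
  also have "\<dots> = quad_form J c a"
    unfolding quad_form_def using assms
    by (intro sum.cong sum.mono_neutral_cong_right) auto
  finally show ?thesis .
qed

lemma covariance_kernel_subset: "covariance_kernel I c \<Longrightarrow> J \<subseteq> I \<Longrightarrow> covariance_kernel J c"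
  unfolding covariance_kernel_def by blast

text \<open>
  The Cauchy-Schwarz inequality in its degenerate case: the quadratic form on \<open>{i, j}\<close> would otherwise be an
  affine function of the coefficient of \<open>i\<close> that takes negative values.
\<close>

lemma covariance_kernel_zero_variance:
  assumes c: "covariance_kernel I c" and ij: "i \<in> I" "j \<in> I" "c i i = 0"
  shows "c i j = 0"
proof (cases "i = j")
  case False
  have *: "0 \<le> 2 * s * c i j + c j j" for s
  proof -
    have "0 \<le> quad_form {i, j} c (\<lambda>k. if k = i then s else 1)"
      by (rule covariance_kernel_nonneg[OF c]) (use ij in auto)
    also have "\<dots> = 2 * s * c i j + c j j"
      using False ij covariance_kernel_sym[OF c ij(2,1)] by (simp add: quad_form_def)
    finally show ?thesis .
  qed
  show ?thesis
  proof (rule ccontr)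
    assume "c i j \<noteq> 0"
    \<comment> \<open>At this coefficient the form takes the value \<open>-1\<close>.\<close>
    define s where "s = - (c j j + 1) / (2 * c i j)"
    have "2 * s * c i j = - (c j j + 1)"
      using \<open>c i j \<noteq> 0\<close> by (simp add: s_def)
    with *[of s] show False by simp
  qed
qed (use ij in simp)

text \<open>
  A Cholesky factorization \<open>c = A A\<^sup>T\<close>, by induction on the index set. A new index with positive variance is
  split off by passing to the Schur complement, which is again positive semidefinite because minimizing the form over
  the new coordinate produces exactly its form.
\<close>

lemma covariance_kernel_factorization:
  assumes "finite J" "covariance_kernel J c"
  shows "\<exists>A :: 'i \<Rightarrow> 'i \<Rightarrow> real. \<forall>i\<in>J. \<forall>j\<in>J. c i j = (\<Sum>l\<in>J. A i l * A j l)"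
  using assms
proof (induction J arbitrary: c)
  case (insert x J)
  have sym: "c i j = c j i" if "i \<in> insert x J" "j \<in> insert x J" for i j
    by (rule covariance_kernel_sym[OF insert.prems that])
  have ne: "l \<noteq> x" if "l \<in> J" for l
    using that insert.hyps by blast
  show ?case
  proof (cases "c x x = 0")
    case True
    obtain A where A: "\<forall>i\<in>J. \<forall>j\<in>J. c i j = (\<Sum>l\<in>J. A i l * A j l)"
      using insert.IH covariance_kernel_subset[OF insert.prems] by blast
    have zero: "c x j = 0" "c j x = 0" if "j \<in> insert x J" for j
      using covariance_kernel_zero_variance[OF insert.prems _ that True] sym[OF that] by auto
    define A' where "A' i l = (if i = x \<or> l = x then 0 else A i l)" for i l
    have "(\<Sum>l\<in>insert x J. A' i l * A' j l) = (if i = x \<or> j = x then 0 else \<Sum>l\<in>J. A i l * A j l)" for i j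
      using insert.hyps ne by (auto simp: A'_def intro!: sum.cong sum.neutral)
    with A zero insert.hyps show ?thesis
      by (intro exI[of _ A']) auto
  next
    case False
    have "c x x \<ge> 0"
    proof -
      have "0 \<le> quad_form {x} c (\<lambda>_. 1)"
        by (rule covariance_kernel_nonneg[OF insert.prems]) auto
      then show ?thesis
        by (simp add: quad_form_def)
    qed
    with False have pos: "c x x > 0" by simp
    \<comment> \<open>The Schur complement: the covariances that remain after projecting out \<open>x\<close>.\<close>
    define c' where "c' i j = c i j - c x i * c x j / c x x" for i j
    have "covariance_kernel J c'"
      unfolding covariance_kernel_def
    proof (intro conjI allI impI ballI)
      fix i j assume "i \<in> J" "j \<in> J"
      then show "c' i j = c' j i"
        using sym[of i j] by (simp add: c'_def mult.commute)
    next
      fix K a assume K: "finite K \<and> K \<subseteq> J"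
      define s where "s = (\<Sum>j\<in>K. a j * c x j)"
      \<comment> \<open>The coefficient at \<open>x\<close> minimizes the quadratic form for given coefficients on \<open>K\<close>.\<close>
      define b where "b i = (if i = x then - s / c x x else a i)" for i
      have xK: "x \<notin> K" using K insert.hyps by blast
      have bK: "b i = a i" if "i \<in> K" for i using that xK by (auto simp: b_def)
      have "0 \<le> quad_form (insert x K) c b"
        by (rule covariance_kernel_nonneg[OF insert.prems]) (use K in auto)
      also have "\<dots> = (b x)\<^sup>2 * c x x + 2 * b x * (\<Sum>j\<in>K. b j * c x j) + quad_form K c b"
        by (rule quad_form_insert) (use K xK sym in auto)
      also have "\<dots> = (s / c x x)\<^sup>2 * c x x - 2 * (s / c x x) * s + quad_form K c a"
        using bK quad_form_cong[of K b a c] by (simp add: s_def) (simp add: b_def s_def)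
      also have "\<dots> = quad_form K c a - s * s / c x x"
        using pos by (simp add: power2_eq_square field_simps)
      also have "\<dots> = quad_form K c' a"
        unfolding quad_form_def c'_def s_def sum_product
        by (simp add: right_diff_distrib sum_subtractf sum_divide_distrib mult_ac)
      finally show "0 \<le> quad_form K c' a" .
    qed
    then obtain A where A: "\<forall>i\<in>J. \<forall>j\<in>J. c' i j = (\<Sum>l\<in>J. A i l * A j l)"
      using insert.IH by blast
    define A' where "A' i l = (if l = x then c x i / sqrt (c x x) else if i = x then 0 else A i l)" for i l
    have sq: "sqrt (c x x) * sqrt (c x x) = c x x" using pos by simp
    have *: "(\<Sum>l\<in>insert x J. A' i l * A' j l) = c x i * c x j / c x x +
      (if i = x \<or> j = x then 0 else \<Sum>l\<in>J. A i l * A j l)" for i j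
    proof -
      have "(\<Sum>l\<in>J. A' i l * A' j l) = (if i = x \<or> j = x then 0 else \<Sum>l\<in>J. A i l * A j l)"
        using ne by (auto simp: A'_def intro!: sum.cong sum.neutral)
      moreover have "A' i x * A' j x = c x i * c x j / c x x"
        using sq by (simp add: A'_def)
      ultimately show ?thesis
        using insert.hyps by simp
    qed
    have "c i j = (\<Sum>l\<in>insert x J. A' i l * A' j l)" if ij: "i \<in> insert x J" "j \<in> insert x J" for i j
    proof (cases "i = x \<or> j = x")
      case True
      then show ?thesis
        using * pos sym[of i x] ij by (elim disjE) simp_all
    next
      case False
      then have "c' i j = (\<Sum>l\<in>J. A i l * A j l)"
        using A ij by blast
      then show ?thesis
        unfolding * using False by (simp add: c'_def)
    qed
    then show ?thesis
      by (intro exI[of _ A'] ballI)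
  qed
qed simp

text \<open>
  The law of \<open>A \<xi>\<close>, where \<open>\<xi>\<close> has independent standard normal coordinates and \<open>c = A A\<^sup>T\<close>.
\<close>

lemma ex_gaussian_measure:
  assumes J: "finite J" and c: "covariance_kernel J c"
  shows "\<exists>P. prob_space P \<and> sets P = sets (PiM J (\<lambda>_. borel)) \<and>
    (\<forall>t. char_fun J P t = exp (- quad_form J c t / 2))"
proof -
  obtain A :: "'a \<Rightarrow> 'a \<Rightarrow> real" where A: "\<And>i j. i \<in> J \<Longrightarrow> j \<in> J \<Longrightarrow> c i j = (\<Sum>l\<in>J. A i l * A j l)"
    using covariance_kernel_factorization[OF J c] by blast
  define W where "W = PiM J (\<lambda>_::'a. std_normal_distribution)"
  interpret std: real_distribution std_normal_distribution
    by (rule real_dist_normal_dist)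
  interpret W: product_prob_space "\<lambda>_::'a. std_normal_distribution" J
    by unfold_locales
  interpret PW: prob_space W
    unfolding W_def by (rule prob_space_PiM) (rule std.prob_space_axioms)
  have setsW[measurable_cong]: "sets W = sets (PiM J (\<lambda>_. borel))"
    unfolding W_def by (intro sets_PiM_cong) auto
  let ?\<phi> = "\<lambda>x. \<lambda>i\<in>J. \<Sum>l\<in>J. A i l * x l"
  have \<phi>[measurable]: "?\<phi> \<in> measurable W (PiM J (\<lambda>_. borel))"
    by measurable
  define P where "P = distr W (PiM J (\<lambda>_. borel)) ?\<phi>"
  have "char_fun J P t = exp (- quad_form J c t / 2)" for t
  proof -
    define b where "b l = (\<Sum>i\<in>J. t i * A i l)" for l
    have lin: "(\<Sum>i\<in>J. t i * ?\<phi> x i) = (\<Sum>l\<in>J. b l * x l)" for x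
    proof -
      have "(\<Sum>i\<in>J. t i * ?\<phi> x i) = (\<Sum>i\<in>J. \<Sum>l\<in>J. t i * A i l * x l)"
        by (simp add: sum_distrib_left mult.assoc)
      also have "\<dots> = (\<Sum>l\<in>J. b l * x l)"
        unfolding b_def sum_distrib_right by (rule sum.swap)
      finally show ?thesis .
    qed
    have "(\<Sum>l\<in>J. (b l)\<^sup>2) = (\<Sum>l\<in>J. \<Sum>i\<in>J. \<Sum>j\<in>J. t i * t j * (A i l * A j l))"
      by (simp add: b_def power2_eq_square sum_product mult_ac)
    also have "\<dots> = (\<Sum>i\<in>J. \<Sum>l\<in>J. \<Sum>j\<in>J. t i * t j * (A i l * A j l))"
      by (rule sum.swap)
    also have "\<dots> = (\<Sum>i\<in>J. \<Sum>j\<in>J. \<Sum>l\<in>J. t i * t j * (A i l * A j l))"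
      by (intro sum.cong refl sum.swap)
    also have "\<dots> = quad_form J c t"
      unfolding quad_form_def by (intro sum.cong refl) (simp add: A sum_distrib_left)
    finally have b: "(\<Sum>l\<in>J. (b l)\<^sup>2) = quad_form J c t" .
    have "char_fun J P t = (CLINT x|W. iexp (\<Sum>i\<in>J. t i * ?\<phi> x i))"
      unfolding P_def by (rule integral_distr) measurable
    also have "\<dots> = (CLINT x|W. iexp (\<Sum>l\<in>J. b l * x l))"
      by (simp only: lin)
    also have "\<dots> = (CLINT x|W. (\<Prod>l\<in>J. iexp (b l * x l)))"
      by (simp add: exp_sum[OF J, symmetric] sum_distrib_left)
    also have "\<dots> = (\<Prod>l\<in>J. CLINT u|std_normal_distribution. iexp (b l * u))"
      unfolding W_def
    proof (rule W.product_integral_prod[OF J, where f="\<lambda>l u. iexp (b l * u)"])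
      show "integrable std_normal_distribution (\<lambda>u. iexp (b l * u))" for l
        by (rule std.integrable_iexp) auto
    qed
    also have "\<dots> = (\<Prod>l\<in>J. char std_normal_distribution (b l))"
      by (simp add: char_def)
    also have "\<dots> = complex_of_real (\<Prod>l\<in>J. exp (- (b l)\<^sup>2 / 2))"
      by (simp add: char_std_normal_distribution)
    also have "(\<Prod>l\<in>J. exp (- (b l)\<^sup>2 / 2)) = exp (\<Sum>l\<in>J. - (b l)\<^sup>2 / 2)"
      by (rule exp_sum[OF J, symmetric])
    also have "(\<Sum>l\<in>J. - (b l)\<^sup>2 / 2) = - quad_form J c t / 2"
      by (simp only: sum_negf sum_divide_distrib[symmetric] b)
    finally show ?thesis .
  qed
  moreover have "prob_space P"
    unfolding P_def by (rule PW.prob_space_distr[OF \<phi>])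
  moreover have "sets P = sets (PiM J (\<lambda>_. borel))"
    by (simp add: P_def)
  ultimately show ?thesis by blast
qed


section \<open>Gaussian processes\<close>

text \<open>
  Kolmogorov's extension theorem. The Gaussian laws on finite sets of indices are consistent because restricting
  to a subset amounts to setting the remaining arguments of the characteristic function to \<open>0\<close>, and a law is
  determined by its characteristic function.
\<close>

lemma ex_gaussian_family:
  fixes I :: "'i set" and c :: "'i \<Rightarrow> 'i \<Rightarrow> real"
  assumes c: "covariance_kernel I c"
  shows "\<exists>N. prob_space N \<and> sets N = sets (PiM I (\<lambda>_. borel)) \<and>
    (\<forall>J t. finite J \<longrightarrow> J \<subseteq> I \<longrightarrow> (CLINT x|N. iexp (\<Sum>i\<in>J. t i * x i)) = exp (- quad_form J c t / 2))"
proof -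
  define G where "G J P \<longleftrightarrow> prob_space P \<and> sets P = sets (PiM J (\<lambda>_. borel)) \<and>
    (\<forall>t. char_fun J P t = exp (- quad_form J c t / 2))" for J P
  define P where "P J = (SOME P. G J P)" for J
  have PG: "prob_space (P J)" "sets (P J) = sets (PiM J (\<lambda>_. borel))"
    "char_fun J (P J) t = exp (- quad_form J c t / 2)" if "finite J" "J \<subseteq> I" for J t
  proof -
    have "\<exists>Q. G J Q"
      using ex_gaussian_measure[OF that(1) covariance_kernel_subset[OF c that(2)]] unfolding G_def .
    then have "G J (P J)"
      unfolding P_def by (rule someI_ex)
    then show "prob_space (P J)" "sets (P J) = sets (PiM J (\<lambda>_. borel))"
      "char_fun J (P J) t = exp (- quad_form J c t / 2)"
      unfolding G_def by auto
  qed
  have restr: "(\<lambda>x. restrict x J) \<in> measurable M (PiM J (\<lambda>_. borel :: real measure))"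
    if "J \<subseteq> H" "sets M = sets (PiM H (\<lambda>_. borel))" for J H :: "'i set" and M
    using measurable_restrict_subset[OF that(1)] measurable_cong_sets[OF that(2) refl] by blast
  interpret polish_projective I P
  proof (rule polish_projective.intro, rule projective_family.intro)
    fix J H assume JH: "J \<subseteq> H" "finite H" "H \<subseteq> I"
    then have J: "finite J" "J \<subseteq> I"
      using finite_subset by auto
    note PH = PG[OF JH(2,3)] and PJ = PG[OF J] and r = restr[OF JH(1) PG(2)[OF JH(2,3)]]
    show "P J = distr (P H) (PiM J (\<lambda>_. borel)) (\<lambda>f. restrict f J)"
    proof (rule measure_eqI_char_fun[OF J(1) PJ(1,2)])
      show "prob_space (distr (P H) (PiM J (\<lambda>_. borel)) (\<lambda>f. restrict f J))"
        by (rule prob_space.prob_space_distr[OF PH(1) r])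
      fix t :: "'i \<Rightarrow> real"
      have sum: "(\<Sum>i\<in>J. t i * restrict x J i) = (\<Sum>i\<in>H. (if i \<in> J then t i else 0) * x i)" for x
        using JH by (intro sum.mono_neutral_cong_left) auto
      have "char_fun J (distr (P H) (PiM J (\<lambda>_. borel)) (\<lambda>f. restrict f J)) t =
        (CLINT x|P H. iexp (\<Sum>i\<in>J. t i * restrict x J i))"
        by (rule integral_distr[OF r]) measurable
      also have "\<dots> = char_fun H (P H) (\<lambda>i. if i \<in> J then t i else 0)"
        by (simp only: sum)
      also have "\<dots> = char_fun J (P J) t"
        unfolding PH(3) PJ(3) quad_form_extend_0[OF JH(1,2)] ..
      finally show "char_fun J (P J) t = char_fun J (distr (P H) (PiM J (\<lambda>_. borel)) (\<lambda>f. restrict f J)) t"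
        by simp
    qed simp
  qed (rule PG(1))
  have "(CLINT x|lim. iexp (\<Sum>i\<in>J. t i * x i)) = exp (- quad_form J c t / 2)"
    if J: "finite J" "J \<subseteq> I" for J t
  proof -
    note r = restr[OF J(2) sets_lim]
    have marg: "distr lim (PiM J (\<lambda>_. borel)) (\<lambda>x. restrict x J) = P J"
    proof (rule measure_eqI)
      fix A assume "A \<in> sets (distr lim (PiM J (\<lambda>_. borel)) (\<lambda>x. restrict x J))"
      then have A: "A \<in> sets (PiM J (\<lambda>_. borel))" by simp
      have "emeasure (distr lim (PiM J (\<lambda>_. borel)) (\<lambda>x. restrict x J)) A = emeasure lim (emb I J A)"
        using A by (subst emeasure_distr[OF r]) (auto simp: prod_emb_def space_PiM)
      also have "\<dots> = emeasure (P J) A"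
        by (rule emeasure_lim_emb[OF J(2,1) A])
      finally show "emeasure (distr lim (PiM J (\<lambda>_. borel)) (\<lambda>x. restrict x J)) A = emeasure (P J) A" .
    qed (use PG(2)[OF J] in simp)
    have "(CLINT x|lim. iexp (\<Sum>i\<in>J. t i * x i)) = (CLINT x|lim. iexp (\<Sum>i\<in>J. t i * restrict x J i))"
      by simp
    also have "\<dots> = char_fun J (distr lim (PiM J (\<lambda>_. borel)) (\<lambda>x. restrict x J)) t"
      by (rule integral_distr[OF r, symmetric]) measurable
    also have "\<dots> = exp (- quad_form J c t / 2)"
      unfolding marg by (rule PG(3)[OF J])
    finally show ?thesis .
  qed
  then show ?thesis
    using P.prob_space_axioms sets_lim by blast
qed

text \<open>
  A variable with this characteristic function has the law of \<open>sqrt v\<close> times a standard normal variable, which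
  also settles the degenerate case \<open>v = 0\<close>.
\<close>

lemma gaussian_char:
  assumes N: "prob_space N" and U: "U \<in> borel_measurable N" and v: "v \<ge> 0"
    and char: "\<And>s. (CLINT x|N. iexp (s * U x)) = exp (- s\<^sup>2 * v / 2)"
  shows "gaussian_rv N U" "integrable N U" "integrable N (\<lambda>x. (U x)\<^sup>2)"
    "(LINT x|N. U x) = 0" "(LINT x|N. (U x)\<^sup>2) = v"
proof -
  interpret N: prob_space N by fact
  interpret std: real_distribution std_normal_distribution
    by (rule real_dist_normal_dist)
  define \<sigma> where "\<sigma> = sqrt v"
  have \<sigma>: "\<sigma> \<ge> 0" "\<sigma>\<^sup>2 = v" using v by (auto simp: \<sigma>_def)
  have [measurable]: "(\<lambda>u. \<sigma> * u) \<in> borel_measurable std_normal_distribution"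
    by simp
  have law: "distr N borel U = distr std_normal_distribution borel (\<lambda>u. \<sigma> * u)"
  proof (rule Levy_uniqueness)
    show "real_distribution (distr N borel U)"
      by (rule N.real_distribution_distr[OF U])
    show "real_distribution (distr std_normal_distribution borel (\<lambda>u. \<sigma> * u))"
      by (rule std.real_distribution_distr) simp
    show "char (distr N borel U) = char (distr std_normal_distribution borel (\<lambda>u. \<sigma> * u))"
    proof
      fix s
      have "char (distr std_normal_distribution borel (\<lambda>u. \<sigma> * u)) s = char std_normal_distribution (s * \<sigma>)"
        unfolding char_def by (subst integral_distr) (auto simp: mult.assoc)
      also have "\<dots> = exp (- s\<^sup>2 * v / 2)"
        by (simp add: char_std_normal_distribution power_mult_distrib \<sigma>)
      also have "\<dots> = char (distr N borel U) s"
        unfolding char[symmetric] char_def by (rule integral_distr[OF U, symmetric]) measurable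
      finally show "char (distr N borel U) s = char (distr std_normal_distribution borel (\<lambda>u. \<sigma> * u)) s" ..
    qed
  qed
  have m1: "integrable std_normal_distribution (\<lambda>u. \<sigma> * u)"
    using integrable_std_normal_distribution_moment[of 1] by simp
  have m2: "integrable std_normal_distribution (\<lambda>u. (\<sigma> * u)\<^sup>2)"
    using integrable_std_normal_distribution_moment[of 2] by (simp add: power_mult_distrib)
  have tr: "integrable N (\<lambda>x. g (U x)) \<longleftrightarrow> integrable std_normal_distribution (\<lambda>u. g (\<sigma> * u))"
    "(LINT x|N. g (U x)) = (LINT u|std_normal_distribution. g (\<sigma> * u))"
    if "g \<in> borel_measurable borel" for g :: "real \<Rightarrow> real"
  proof -
    have "integrable (distr N borel U) g \<longleftrightarrow> integrable (distr std_normal_distribution borel (\<lambda>u. \<sigma> * u)) g"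
      by (simp add: law)
    then show "integrable N (\<lambda>x. g (U x)) \<longleftrightarrow> integrable std_normal_distribution (\<lambda>u. g (\<sigma> * u))"
      using that U by (subst (asm) (1 2) integrable_distr_eq) auto
    have "integral\<^sup>L (distr N borel U) g = integral\<^sup>L (distr std_normal_distribution borel (\<lambda>u. \<sigma> * u)) g"
      by (simp add: law)
    then show "(LINT x|N. g (U x)) = (LINT u|std_normal_distribution. g (\<sigma> * u))"
      using that U by (subst (asm) (1 2) integral_distr) auto
  qed
  show "integrable N U" "integrable N (\<lambda>x. (U x)\<^sup>2)"
    using tr(1)[of "\<lambda>u. u"] tr(1)[of "\<lambda>u. u\<^sup>2"] m1 m2 by auto
  show "(LINT x|N. U x) = 0"
    using tr(2)[of "\<lambda>u. u"] integral_std_normal_distribution_moment_odd[of 1] by simp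
  show "(LINT x|N. (U x)\<^sup>2) = v"
    using tr(2)[of "\<lambda>u. u\<^sup>2"] std_normal_distribution_even_moments(1)[of 1]
    by (simp add: power_mult_distrib \<sigma> fact_numeral)
  show "gaussian_rv N U"
    unfolding gaussian_rv_def
  proof (rule conjI[OF U], rule exI[of _ 0], rule exI[of _ \<sigma>], rule conjI[OF \<sigma>(1)])
    show "distr N borel U = (if \<sigma> = 0 then return borel 0
      else density lborel (\<lambda>x. ennreal (normal_density 0 \<sigma> x)))"
    proof (cases "\<sigma> = 0")
      case True
      then show ?thesis
        using law std.distr_const[of 0 borel] by simp
    next
      case False
      with \<sigma> have "0 < \<sigma>" by simp
      have "distributed std_normal_distribution lborel (\<lambda>u. u) std_normal_density"
        unfolding distributed_def by (auto simp: distr_id2)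
      from std.normal_density_affine[OF this, of \<sigma> 0] \<open>0 < \<sigma>\<close>
      have "distributed std_normal_distribution lborel (\<lambda>u. \<sigma> * u) (normal_density 0 \<sigma>)"
        by simp
      then have "distr std_normal_distribution lborel (\<lambda>u. \<sigma> * u) = density lborel (\<lambda>x. ennreal (normal_density 0 \<sigma> x))"
        by (simp add: distributed_def)
      moreover have "distr std_normal_distribution lborel (\<lambda>u. \<sigma> * u) = distr std_normal_distribution borel (\<lambda>u. \<sigma> * u)"
        by (intro distr_cong) auto
      ultimately show ?thesis
        using law False by simp
    qed
  qed
qed

text \<open>
  The coordinate process under the measure of \<open>ex_gaussian_family\<close>. Mixed moments follow from the variances
  of sums by polarization.
\<close>

lemma ex_centered_gaussian_process:
  fixes I :: "'i set" and c :: "'i \<Rightarrow> 'i \<Rightarrow> real"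
  assumes c: "covariance_kernel I c"
  shows "\<exists>(N :: ('i \<Rightarrow> real) measure) Z. centered_gaussian_process N I Z c \<and>
    (\<forall>i\<in>I. Z i \<in> borel_measurable N) \<and>
    (\<forall>J t. finite J \<longrightarrow> J \<subseteq> I \<longrightarrow> (CLINT x|N. iexp (\<Sum>i\<in>J. t i * Z i x)) = exp (- quad_form J c t / 2))"
proof -
  obtain N where N: "prob_space N" "sets N = sets (PiM I (\<lambda>_. borel :: real measure))"
    and ch: "\<And>J t. finite J \<Longrightarrow> J \<subseteq> I \<Longrightarrow> (CLINT x|N. iexp (\<Sum>i\<in>J. t i * x i)) = exp (- quad_form J c t / 2)"
    using ex_gaussian_family[OF c] by blast
  define Z where "Z i x = x i" for i and x :: "'i \<Rightarrow> real"
  have Z: "Z i \<in> borel_measurable N" if "i \<in> I" for i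
    using that measurable_cong_sets[OF N(2) refl] unfolding Z_def[abs_def] by (metis measurable_component_singleton)
  have lin: "(\<lambda>x. \<Sum>i\<in>J. a i * Z i x) \<in> borel_measurable N" if "J \<subseteq> I" for J a
    using that Z by (intro borel_measurable_sum borel_measurable_times) auto
  have pos: "0 \<le> quad_form J c a" if "finite J" "J \<subseteq> I" for J a
    using c that unfolding covariance_kernel_def by blast
  have chs: "(CLINT x|N. iexp (s * (\<Sum>i\<in>J. a i * Z i x))) = exp (- s\<^sup>2 * quad_form J c a / 2)"
    if "finite J" "J \<subseteq> I" for J a s
  proof -
    have "s * (\<Sum>i\<in>J. a i * Z i x) = (\<Sum>i\<in>J. (s * a i) * x i)" for x
      by (simp add: Z_def sum_distrib_left mult.assoc)
    then have "(CLINT x|N. iexp (s * (\<Sum>i\<in>J. a i * Z i x))) = (CLINT x|N. iexp (\<Sum>i\<in>J. (s * a i) * x i))"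
      by (simp only:)
    also have "\<dots> = exp (- s\<^sup>2 * quad_form J c a / 2)"
      unfolding ch[OF that] quad_form_scale by simp
    finally show ?thesis .
  qed
  note gauss = gaussian_char[OF N(1) lin pos chs]
  have Zi: "integrable N (Z i)" "integrable N (\<lambda>x. (Z i x)\<^sup>2)" "(LINT x|N. Z i x) = 0" "(LINT x|N. (Z i x)\<^sup>2) = c i i"
    if "i \<in> I" for i
    using gauss[of "{i}" "\<lambda>_. 1"] that by (simp_all add: quad_form_def)
  have "centered_gaussian_process N I Z c"
    unfolding centered_gaussian_process_def
  proof (intro conjI allI impI ballI N)
    fix J and a :: "'i \<Rightarrow> real" assume "finite J \<and> J \<subseteq> I"
    then show "gaussian_rv N (\<lambda>x. \<Sum>i\<in>J. a i * Z i x)"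
      using gauss(1)[of J a] by blast
  next
    fix i assume "i \<in> I"
    then show "(LINT x|N. Z i x) = 0" by (rule Zi)
  next
    fix i j assume ij: "i \<in> I" "j \<in> I"
    show "cov N (Z i) (Z j) = c i j"
    proof (cases "i = j")
      case True
      then show ?thesis
        using Zi[OF ij(1)] by (simp add: cov_def power2_eq_square)
    next
      case False
      have sym: "c j i = c i j"
        using c ij unfolding covariance_kernel_def by blast
      have s: "integrable N (\<lambda>x. (Z i x + Z j x)\<^sup>2)" "(LINT x|N. (Z i x + Z j x)\<^sup>2) = c i i + c j j + 2 * c i j"
        using gauss(3,5)[of "{i, j}" "\<lambda>_. 1"] ij False sym by (simp_all add: quad_form_def)
      have "(LINT x|N. Z i x * Z j x) = (LINT x|N. ((Z i x + Z j x)\<^sup>2 - (Z i x)\<^sup>2 - (Z j x)\<^sup>2) / 2)"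
        by (simp add: power2_sum field_simps)
      also have "\<dots> = ((LINT x|N. (Z i x + Z j x)\<^sup>2) - (LINT x|N. (Z i x)\<^sup>2) - (LINT x|N. (Z j x)\<^sup>2)) / 2"
        using s(1) Zi(2)[OF ij(1)] Zi(2)[OF ij(2)] by simp
      also have "\<dots> = c i j"
        using s(2) Zi(4)[OF ij(1)] Zi(4)[OF ij(2)] by simp
      finally show ?thesis
        using Zi(3)[OF ij(1)] by (simp add: cov_def)
    qed
  qed
  moreover have "(CLINT x|N. iexp (\<Sum>i\<in>J. t i * Z i x)) = exp (- quad_form J c t / 2)" if "finite J" "J \<subseteq> I" for J t
    using ch[OF that] by (simp add: Z_def)
  ultimately show ?thesis
    using Z by blast
qed


section \<open>A central limit theorem without independence\<close>

lemma iexp_measurable[measurable]: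
  "U \<in> borel_measurable M \<Longrightarrow> (\<lambda>x. iexp (U x)) \<in> borel_measurable M"
  by measurable

definition tail_sq :: "real \<Rightarrow> real \<Rightarrow> real" where
  "tail_sq e u = (if \<bar>u\<bar> > e then u\<^sup>2 else 0)"

lemma tail_sq_nonneg: "0 \<le> tail_sq e u"
  and tail_sq_le: "tail_sq e u \<le> u\<^sup>2"
  by (auto simp: tail_sq_def)

lemma tail_sq_measurable[measurable]: "tail_sq e \<in> borel_measurable borel"
  unfolding tail_sq_def[abs_def] by measurable

lemma square_le_tail_sq: "u\<^sup>2 \<le> e\<^sup>2 + tail_sq e u"
proof (cases "\<bar>u\<bar> > e")
  case False
  then have "u\<^sup>2 \<le> e\<^sup>2"
    using power_mono[of "\<bar>u\<bar>" e 2] by simp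
  then show ?thesis using False by (simp add: tail_sq_def)
qed (simp add: tail_sq_def)

lemma tail_sq_divide: "a > 0 \<Longrightarrow> tail_sq e (u / a) = tail_sq (e * a) u / a\<^sup>2"
  by (simp add: tail_sq_def power_divide pos_less_divide_eq)

text \<open>
  If a linear combination is large, then its largest summand variable is large and dominates it. Hence the
  Lindeberg condition passes from the components to their linear combinations.
\<close>

lemma tail_sq_linear_combination:
  fixes t w :: "'i \<Rightarrow> real"
  assumes A: "finite A" and "e > 0"
  defines "T \<equiv> 1 + (\<Sum>i\<in>A. \<bar>t i\<bar>)"
  shows "tail_sq e (\<Sum>i\<in>A. t i * w i) \<le> T\<^sup>2 * (\<Sum>i\<in>A. tail_sq (e / T) (w i))"
proof (cases "\<bar>\<Sum>i\<in>A. t i * w i\<bar> > e")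
  case True
  then have "A \<noteq> {}" using \<open>e > 0\<close> by auto
  \<comment> \<open>The term \<open>1\<close> in \<open>T\<close> makes the threshold \<open>e / T\<close> meaningful when all weights vanish.\<close>
  have "T > 0" unfolding T_def by (simp add: add_pos_nonneg sum_nonneg)
  define b where "b = Max ((\<lambda>i. \<bar>w i\<bar>) ` A)"
  have "b \<in> (\<lambda>i. \<bar>w i\<bar>) ` A"
    unfolding b_def using A \<open>A \<noteq> {}\<close> by (intro Max_in) auto
  then obtain i where i: "i \<in> A" "b = \<bar>w i\<bar>" by auto
  have wb: "\<bar>w j\<bar> \<le> b" if "j \<in> A" for j
    unfolding b_def using A that by (intro Max_ge) auto
  have "\<bar>\<Sum>i\<in>A. t i * w i\<bar> \<le> (\<Sum>i\<in>A. \<bar>t i * w i\<bar>)"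
    by (rule sum_abs)
  also have "\<dots> \<le> (\<Sum>i\<in>A. \<bar>t i\<bar> * b)"
    unfolding abs_mult by (intro sum_mono mult_left_mono wb) auto
  also have "\<dots> \<le> T * b"
    unfolding T_def using i by (simp add: sum_distrib_right[symmetric] distrib_right)
  finally have U: "\<bar>\<Sum>i\<in>A. t i * w i\<bar> \<le> T * b" .
  with True have "e < T * b" by linarith
  then have big: "e / T < \<bar>w i\<bar>"
    using \<open>T > 0\<close> i by (simp add: pos_divide_less_eq mult.commute)
  have "(\<Sum>i\<in>A. t i * w i)\<^sup>2 \<le> (T * b)\<^sup>2"
    using power_mono[OF U, of 2] by simp
  also have "\<dots> = T\<^sup>2 * tail_sq (e / T) (w i)"
    using big i by (simp add: tail_sq_def power_mult_distrib)
  also have "\<dots> \<le> T\<^sup>2 * (\<Sum>i\<in>A. tail_sq (e / T) (w i))"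
    using i A by (intro mult_left_mono member_le_sum) (auto simp: tail_sq_nonneg)
  finally show ?thesis
    using True by (simp add: tail_sq_def)
qed (simp add: tail_sq_def sum_nonneg)

context prob_space begin

lemma integrable_tail_sq:
  assumes "W \<in> borel_measurable M" "integrable M (\<lambda>x. (W x)\<^sup>2)"
  shows "integrable M (\<lambda>x. tail_sq e (W x))"
  by (rule Bochner_Integration.integrable_bound[OF assms(2)])
    (use assms(1) tail_sq_le tail_sq_nonneg in auto)

lemma cmod_expectation_iexp_le_1: "cmod (CLINT x|M. iexp (U x)) \<le> 1"
proof (cases "integrable M (\<lambda>x. iexp (U x))")
  case True
  have "cmod (CLINT x|M. iexp (U x)) \<le> (LINT x|M. cmod (iexp (U x)))"
    by (rule integral_norm_bound)
  then show ?thesis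
    by (simp add: prob_space)
qed (simp add: not_integrable_integral_eq)

text \<open>
  How far the characteristic function of a sum is from the product of the individual ones: splitting off the
  last summand costs exactly one covariance, and since the remaining factors have modulus at most \<open>1\<close>, the costs
  add up.
\<close>

lemma char_sum_telescope:
  fixes W :: "nat \<Rightarrow> 'a \<Rightarrow> real"
  shows "cmod ((CLINT x|M. iexp (\<Sum>j=1..m. W j x)) - (\<Prod>j=1..m. CLINT x|M. iexp (W j x))) \<le>
    (\<Sum>j=1..m. cmod (cov M (\<lambda>x. iexp (\<Sum>s\<in>{1..<j}. W s x)) (\<lambda>x. iexp (W j x))))"
proof (induction m)
  case 0
  then show ?case by (simp add: prob_space)
next
  case (Suc m)
  define S where "S = (CLINT x|M. iexp (\<Sum>j=1..m. W j x))"
  define p where "p = (\<Prod>j=1..m. CLINT x|M. iexp (W j x))"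
  define f where "f = (CLINT x|M. iexp (W (Suc m) x))"
  define C where "C = cov M (\<lambda>x. iexp (\<Sum>s\<in>{1..<Suc m}. W s x)) (\<lambda>x. iexp (W (Suc m) x))"
  have "(CLINT x|M. iexp (\<Sum>j=1..Suc m. W j x)) = (CLINT x|M. iexp (\<Sum>j=1..m. W j x) * iexp (W (Suc m) x))"
    by (simp add: exp_add[symmetric] ring_distribs)
  also have "\<dots> = C + S * f"
    unfolding C_def S_def f_def cov_def atLeastLessThanSuc_atLeastAtMost by simp
  finally have "cmod ((CLINT x|M. iexp (\<Sum>j=1..Suc m. W j x)) - p * f) = cmod (C + (S - p) * f)"
    by (simp add: algebra_simps)
  also have "\<dots> \<le> cmod C + cmod (S - p) * cmod f"
    by (metis norm_triangle_ineq norm_mult)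
  also have "\<dots> \<le> cmod C + cmod (S - p)"
    using cmod_expectation_iexp_le_1[of "W (Suc m)"] by (simp add: f_def mult_left_le)
  also have "\<dots> \<le> cmod C + (\<Sum>j=1..m. cmod (cov M (\<lambda>x. iexp (\<Sum>s\<in>{1..<j}. W s x)) (\<lambda>x. iexp (W j x))))"
    using Suc unfolding S_def p_def by simp
  also have "\<dots> = (\<Sum>j=1..Suc m. cmod (cov M (\<lambda>x. iexp (\<Sum>s\<in>{1..<j}. W s x)) (\<lambda>x. iexp (W j x))))"
    unfolding C_def by (rule sum.nat_ivl_Suc'[symmetric]) simp
  also have "p * f = (\<Prod>j=1..Suc m. CLINT x|M. iexp (W j x))"
    unfolding p_def f_def by (subst prod.nat_ivl_Suc') (simp, rule mult.commute)
  finally show ?case .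
qed

text \<open>
  The cubic Taylor bound is used where \<open>\<bar>W\<bar> \<le> e\<close> and the quadratic one on the tail.
\<close>

lemma char_second_order:
  assumes W: "W \<in> borel_measurable M" and sq: "integrable M (\<lambda>x. (W x)\<^sup>2)" and mean: "(LINT x|M. W x) = 0"
    and "e > 0"
  shows "cmod ((CLINT x|M. iexp (W x)) - (1 - (LINT x|M. (W x)\<^sup>2) / 2)) \<le>
    e * (LINT x|M. (W x)\<^sup>2) + (LINT x|M. tail_sq e (W x))"
proof -
  have int: "integrable M W"
    by (rule square_integrable_imp_integrable[OF W sq])
  note tr = integrable_tail_sq[OF W sq, of e]
  have "cmod (char (distr M borel W) 1 - (1 - 1\<^sup>2 * (LINT x|M. (W x)\<^sup>2) / 2)) \<le>
    (1\<^sup>2 / 6) * (LINT x|M. min (6 * (W x)\<^sup>2) (\<bar>1\<bar> * \<bar>W x\<bar> ^ 3))"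
    by (rule char_approx3') (use W sq int mean in auto)
  moreover have "char (distr M borel W) 1 = (CLINT x|M. iexp (W x))"
    unfolding char_def using W by (subst integral_distr) auto
  ultimately have "cmod ((CLINT x|M. iexp (W x)) - (1 - (LINT x|M. (W x)\<^sup>2) / 2)) \<le>
    (LINT x|M. min (6 * (W x)\<^sup>2) (\<bar>W x\<bar> ^ 3)) / 6"
    by simp
  also have "\<dots> = (LINT x|M. min (6 * (W x)\<^sup>2) (\<bar>W x\<bar> ^ 3) / 6)"
    by simp
  also have "\<dots> \<le> (LINT x|M. e * (W x)\<^sup>2 + tail_sq e (W x))"
  proof (rule integral_mono)
    show "integrable M (\<lambda>x. min (6 * (W x)\<^sup>2) (\<bar>W x\<bar> ^ 3) / 6)"
      by (rule Bochner_Integration.integrable_bound[OF sq]) (use W in \<open>auto simp: min_def\<close>)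
    show "integrable M (\<lambda>x. e * (W x)\<^sup>2 + tail_sq e (W x))"
      using sq tr by simp
    fix x
    show "min (6 * (W x)\<^sup>2) (\<bar>W x\<bar> ^ 3) / 6 \<le> e * (W x)\<^sup>2 + tail_sq e (W x)"
    proof (cases "\<bar>W x\<bar> > e")
      case True
      have "min (6 * (W x)\<^sup>2) (\<bar>W x\<bar> ^ 3) / 6 \<le> (W x)\<^sup>2" by simp
      also have "\<dots> \<le> e * (W x)\<^sup>2 + (W x)\<^sup>2"
        using \<open>e > 0\<close> by simp
      finally show ?thesis
        using True by (simp add: tail_sq_def)
    next
      case False
      have "\<bar>W x\<bar> ^ 3 = \<bar>W x\<bar> * (W x)\<^sup>2"
        by (simp add: power3_eq_cube power2_eq_square mult.assoc)
      also have "\<dots> \<le> e * (W x)\<^sup>2"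
        using False by (intro mult_right_mono) auto
      finally have "\<bar>W x\<bar> ^ 3 \<le> e * (W x)\<^sup>2" .
      moreover have "0 \<le> e * (W x)\<^sup>2" using \<open>e > 0\<close> by simp
      ultimately have "min (6 * (W x)\<^sup>2) (\<bar>W x\<bar> ^ 3) / 6 \<le> e * (W x)\<^sup>2"
        by linarith
      then show ?thesis
        using False by (simp add: tail_sq_def)
    qed
  qed
  also have "\<dots> = e * (LINT x|M. (W x)\<^sup>2) + (LINT x|M. tail_sq e (W x))"
    using sq tr by simp
  finally show ?thesis .
qed

lemma second_moment_le_truncated:
  fixes W :: "'a \<Rightarrow> real"
  assumes W: "W \<in> borel_measurable M" and sq: "integrable M (\<lambda>x. (W x)\<^sup>2)"
  shows "(LINT x|M. (W x)\<^sup>2) \<le> e\<^sup>2 + (LINT x|M. tail_sq e (W x))"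
proof -
  note tr = integrable_tail_sq[OF W sq, of e]
  have "(LINT x|M. (W x)\<^sup>2) \<le> (LINT x|M. e\<^sup>2 + tail_sq e (W x))"
    by (rule integral_mono[OF sq]) (use tr square_le_tail_sq in auto)
  also have "\<dots> = e\<^sup>2 + (LINT x|M. tail_sq e (W x))"
    using tr by (simp add: prob_space)
  finally show ?thesis .
qed

text \<open>
  The upper bound comes from \<open>exp (-y) \<le> 1 / (1 + y)\<close>.
\<close>

lemma exp_minus_first_order:
  fixes y :: real
  assumes "y \<ge> 0"
  shows "\<bar>1 - y - exp (- y)\<bar> \<le> y\<^sup>2"
proof -
  have "1 - y \<le> exp (- y)"
    using exp_ge_add_one_self[of "-y"] by simp
  moreover have "exp (- y) \<le> 1 - y + y\<^sup>2"
  proof -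
    have "exp (- y) \<le> 1 / (1 + y)"
      using exp_ge_add_one_self[of y] assms by (simp add: exp_minus inverse_eq_divide frac_le)
    also have "\<dots> \<le> 1 - y + y\<^sup>2"
    proof -
      have "1 \<le> 1 + y ^ 3" using assms by simp
      also have "\<dots> = (1 - y + y\<^sup>2) * (1 + y)"
        by (simp add: power3_eq_cube power2_eq_square algebra_simps)
      finally show ?thesis
        using assms by (simp add: divide_le_eq)
    qed
    finally show ?thesis .
  qed
  ultimately show ?thesis by simp
qed

text \<open>
  A Lindeberg central limit theorem in which independence is replaced by vanishing total covariance of
  characters. By \<open>char_sum_telescope\<close> the characteristic function of the row sum may be replaced by
  \<open>\<phi>\<^sub>n\<^sup>m\<close>, where \<open>\<phi>\<^sub>n\<close> is that of one summand. Then \<open>\<phi>\<^sub>n\<close> is compared with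
  \<open>exp (-q\<^sub>n / 2)\<close>, where \<open>q\<^sub>n\<close> is the variance of one summand; the error has to be \<open>o(1/m)\<close>, and this is
  what the Lindeberg condition provides.
\<close>

lemma char_row_sum_tendsto_gaussian:
  fixes W :: "nat \<Rightarrow> nat \<Rightarrow> 'a \<Rightarrow> real" and m :: "nat \<Rightarrow> nat"
  assumes meas: "\<And>n j. j \<in> {1..m n} \<Longrightarrow> W n j \<in> borel_measurable M"
    and ident: "\<And>n j. j \<in> {1..m n} \<Longrightarrow> (CLINT x|M. iexp (W n j x)) = (CLINT x|M. iexp (W n 1 x))"
    and m: "eventually (\<lambda>n. m n \<ge> 1) sequentially"
    and sq: "eventually (\<lambda>n. integrable M (\<lambda>x. (W n 1 x)\<^sup>2)) sequentially"
    and mean: "eventually (\<lambda>n. (LINT x|M. W n 1 x) = 0) sequentially"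
    and var: "(\<lambda>n. m n * (LINT x|M. (W n 1 x)\<^sup>2)) \<longlonglongrightarrow> v"
    and lind: "\<And>e. e > 0 \<Longrightarrow> (\<lambda>n. m n * (LINT x|M. tail_sq e (W n 1 x))) \<longlonglongrightarrow> 0"
    and dep: "(\<lambda>n. \<Sum>j=1..m n. cmod (cov M (\<lambda>x. iexp (\<Sum>s\<in>{1..<j}. W n s x)) (\<lambda>x. iexp (W n j x)))) \<longlonglongrightarrow> 0"
  shows "(\<lambda>n. CLINT x|M. iexp (\<Sum>j=1..m n. W n j x)) \<longlonglongrightarrow> complex_of_real (exp (- v / 2))"
proof -
  define \<phi> where "\<phi> n = (CLINT x|M. iexp (W n 1 x))" for n
  define q where "q n = (LINT x|M. (W n 1 x)\<^sup>2)" for n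
  define L where "L e n = m n * (LINT x|M. tail_sq e (W n 1 x))" for e n
  have q0: "q n \<ge> 0" for n
    unfolding q_def by simp
  have "(\<lambda>n. m n * q n) \<longlonglongrightarrow> v"
    using var unfolding q_def .
  then have v: "v \<ge> 0"
    by (rule LIMSEQ_le_const) (use q0 in auto)
  have step1: "(\<lambda>n. (CLINT x|M. iexp (\<Sum>j=1..m n. W n j x)) - \<phi> n ^ m n) \<longlonglongrightarrow> 0"
  proof (rule Lim_null_comparison[OF always_eventually dep], rule allI)
    fix n
    have "(\<Prod>j=1..m n. CLINT x|M. iexp (W n j x)) = (\<Prod>j=1..m n. \<phi> n)"
      unfolding \<phi>_def by (intro prod.cong refl ident)
    then show "cmod ((CLINT x|M. iexp (\<Sum>j=1..m n. W n j x)) - \<phi> n ^ m n) \<le>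
      (\<Sum>j=1..m n. cmod (cov M (\<lambda>x. iexp (\<Sum>s\<in>{1..<j}. W n s x)) (\<lambda>x. iexp (W n j x))))"
      using char_sum_telescope[where m="m n" and W="W n"] by simp
  qed
  have bound: "eventually (\<lambda>n. m n * cmod (\<phi> n - exp (- q n / 2)) \<le>
      e * (m n * q n) + L e n + (m n * q n) * (e\<^sup>2 + L e n)) sequentially" if "e > 0" for e
    using m sq mean
  proof eventually_elim
    case (elim n)
    have W: "W n 1 \<in> borel_measurable M"
      using elim(1) by (intro meas) simp
    define l where "l = (LINT x|M. tail_sq e (W n 1 x))"
    have l: "L e n = m n * l" "l \<ge> 0"
      by (simp_all add: L_def l_def tail_sq_nonneg)
    have "l \<le> L e n"
      unfolding l(1) using elim(1) l(2) by (simp add: mult_le_cancel_right1)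
    then have q: "q n \<le> e\<^sup>2 + L e n"
      using second_moment_le_truncated[OF W elim(2), of e] unfolding q_def l_def by linarith
    have a: "cmod (\<phi> n - complex_of_real (1 - q n / 2)) \<le> e * q n + l"
      using char_second_order[OF W elim(2,3) that] unfolding \<phi>_def q_def l_def by simp
    have "\<bar>1 - q n / 2 - exp (- (q n / 2))\<bar> \<le> (q n / 2)\<^sup>2"
      by (rule exp_minus_first_order) (use q0 in simp)
    also have "\<dots> \<le> q n * q n"
      using q0[of n] by (simp add: power2_eq_square)
    finally have b: "cmod (complex_of_real (1 - q n / 2) - complex_of_real (exp (- q n / 2))) \<le> q n * q n"
      by (simp flip: of_real_diff)
    have "cmod (\<phi> n - exp (- q n / 2)) \<le> (e * q n + l) + q n * q n"
      using norm_triangle_ineq[of "\<phi> n - complex_of_real (1 - q n / 2)"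
        "complex_of_real (1 - q n / 2) - complex_of_real (exp (- q n / 2))"] a b
      by (simp only: diff_add_cancel add_diff_eq)
    also have "\<dots> \<le> (e * q n + l) + q n * (e\<^sup>2 + L e n)"
      using q q0 by (intro add_left_mono mult_left_mono) auto
    finally have "m n * cmod (\<phi> n - exp (- q n / 2)) \<le> m n * ((e * q n + l) + q n * (e\<^sup>2 + L e n))"
      by (rule mult_left_mono) simp
    then show ?case
      by (simp add: l(1) algebra_simps)
  qed
  have step2: "(\<lambda>n. m n * cmod (\<phi> n - exp (- q n / 2))) \<longlonglongrightarrow> 0"
  proof (rule LIMSEQ_I)
    fix d :: real assume "d > 0"
    \<comment> \<open>The limit of the bound is \<open>e * v + v * e\<^sup>2 \<le> 2 * e * v\<close>, which this choice makes smaller than \<open>d\<close>.\<close>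
    define e where "e = min 1 (d / (4 * (v + 1)))"
    have e: "e > 0" "e \<le> 1" using \<open>d > 0\<close> v by (auto simp: e_def)
    have "e * v + v * e\<^sup>2 \<le> 2 * (e * v)"
      using e v by (simp add: power2_eq_square mult_le_cancel_left1 mult_left_le mult.commute mult_le_cancel_right1)
        (metis mult.assoc mult.commute mult_left_le mult_nonneg_nonneg less_imp_le)
    also have "\<dots> \<le> 2 * (d / (4 * (v + 1)) * v)"
      using v by (intro mult_left_mono mult_right_mono) (auto simp: e_def)
    also have "\<dots> < d"
      using v \<open>d > 0\<close> by (simp add: field_simps add_pos_nonneg)
    finally have small: "e * v + v * e\<^sup>2 < d" .
    have "(\<lambda>n. e * (m n * q n) + L e n + (m n * q n) * (e\<^sup>2 + L e n)) \<longlonglongrightarrow> e * v + 0 + v * (e\<^sup>2 + 0)"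
      using lind[OF e(1)] unfolding L_def by (intro tendsto_intros \<open>(\<lambda>n. m n * q n) \<longlonglongrightarrow> v\<close>)
    then have "eventually (\<lambda>n. e * (m n * q n) + L e n + (m n * q n) * (e\<^sup>2 + L e n) < d) sequentially"
      by (rule order_tendstoD) (use small in simp)
    with bound[OF e(1)] have "eventually (\<lambda>n. norm (m n * cmod (\<phi> n - exp (- q n / 2)) - 0) < d) sequentially"
      by eventually_elim auto
    then show "\<exists>no. \<forall>n\<ge>no. norm (m n * cmod (\<phi> n - exp (- q n / 2)) - 0) < d"
      by (simp add: eventually_sequentially)
  qed
  have step3: "(\<lambda>n. \<phi> n ^ m n - exp (- (m n * q n) / 2)) \<longlonglongrightarrow> 0"
  proof (rule Lim_null_comparison[OF always_eventually step2], rule allI)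
    fix n
    have "complex_of_real (exp (- (m n * q n) / 2)) = complex_of_real (exp (- q n / 2)) ^ m n"
      by (simp add: exp_of_nat_mult[symmetric] flip: of_real_power)
    then show "cmod (\<phi> n ^ m n - exp (- (m n * q n) / 2)) \<le> m n * cmod (\<phi> n - exp (- q n / 2))"
      using norm_power_diff[of "\<phi> n" "complex_of_real (exp (- q n / 2))" "m n"] q0[of n]
        cmod_expectation_iexp_le_1[of "W n 1"] by (simp add: \<phi>_def)
  qed
  have "(\<lambda>n. complex_of_real (exp (- (m n * q n) / 2))) \<longlonglongrightarrow> complex_of_real (exp (- v / 2))"
    by (intro tendsto_intros \<open>(\<lambda>n. m n * q n) \<longlonglongrightarrow> v\<close>) simp
  from tendsto_add[OF tendsto_add[OF step1 step3] this] show ?thesis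
    by simp
qed

end


section \<open>Blocks of a stationary array\<close>

text \<open>
  A generator of the \<open>\<sigma>\<close>-field contains lists of one length only, so that its preimage is either empty or the
  product set from which it was built.
\<close>

lemma upt_list_measurable:
  assumes "r \<ge> 1"
  shows "(\<lambda>w. map w [0..<r]) \<in> measurable (PiM {..<r} (\<lambda>_. restrict_space borel E)) (fin_seqs_space E)"
proof -
  let ?P = "\<lambda>r. PiM {..<r} (\<lambda>_. restrict_space borel E)"
  let ?G = "\<Union>r\<in>{1..}. (\<lambda>B. (\<lambda>w. map w [0..<r]) ` B) ` sets (?P r)"
  have sp: "space (?P r) = PiE {..<r} (\<lambda>_. E)" for r :: nat
    by (simp add: space_PiM space_restrict_space)
  have sub: "B \<subseteq> PiE {..<r} (\<lambda>_. E)" if "B \<in> sets (?P r)" for B and r :: nat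
    using sets.sets_into_space[OF that] by (simp add: sp)
  have seqs: "map w [0..<q] \<in> fin_seqs E" if "w \<in> PiE {..<q} (\<lambda>_. E)" "q \<ge> 1" for w q
    using that by (auto simp: fin_seqs_def PiE_iff)
  have gen: "\<exists>q B. q \<ge> 1 \<and> B \<in> sets (?P q) \<and> y = (\<lambda>w. map w [0..<q]) ` B" if "y \<in> ?G" for y
  proof -
    from that obtain q where "q \<in> {1..}" "y \<in> (\<lambda>B. (\<lambda>w. map w [0..<q]) ` B) ` sets (?P q)"
      by (rule UN_E)
    then show ?thesis
      by (elim imageE) (auto intro!: exI[of _ q])
  qed
  have inj: "w = w'" if "w \<in> PiE {..<r} (\<lambda>_. E)" "w' \<in> PiE {..<r} (\<lambda>_. E)" "map w [0..<r] = map w' [0..<r]"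
    for w w' :: "nat \<Rightarrow> 'a"
    by (rule PiE_ext[OF that(1,2)]) (use that(3) in simp)
  have "(\<lambda>w. map w [0..<r]) \<in> measurable (?P r) (sigma (fin_seqs E) ?G)"
  proof (rule measurable_measure_of)
    show "?G \<subseteq> Pow (fin_seqs E)"
    proof
      fix y assume "y \<in> ?G"
      from gen[OF this] obtain q B where q: "q \<ge> 1" and B: "B \<in> sets (?P q)" and y: "y = (\<lambda>w. map w [0..<q]) ` B"
        by blast
      have "map w [0..<q] \<in> fin_seqs E" if "w \<in> B" for w
        by (rule seqs[OF _ q]) (use sub[OF B] that in blast)
      then show "y \<in> Pow (fin_seqs E)"
        unfolding y by blast
    qed
    show "(\<lambda>w. map w [0..<r]) \<in> space (?P r) \<rightarrow> fin_seqs E"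
      using assms seqs by (simp add: sp)
    fix y assume "y \<in> ?G"
    from gen[OF this] obtain q B where B: "B \<in> sets (?P q)" and y: "y = (\<lambda>w. map w [0..<q]) ` B"
      by blast
    show "(\<lambda>w. map w [0..<r]) -` y \<inter> space (?P r) \<in> sets (?P r)"
    proof (cases "q = r")
      case False
      have "length u = q" if "u \<in> y" for u
        using that unfolding y by auto
      then have "map w [0..<r] \<notin> y" for w
        using False by force
      then have "(\<lambda>w. map w [0..<r]) -` y \<inter> space (?P r) = {}"
        by blast
      then show ?thesis by simp
    next
      case True
      have "(\<lambda>w. map w [0..<r]) -` y \<inter> space (?P r) = B"
      proof (intro equalityI subsetI)
        fix w assume w: "w \<in> (\<lambda>w. map w [0..<r]) -` y \<inter> space (?P r)"
        then obtain w' where w': "w' \<in> B" "map w [0..<r] = map w' [0..<r]"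
          unfolding y True by blast
        then have "w = w'"
          using sub[OF B] w unfolding True sp by (intro inj) auto
        with w' show "w \<in> B" by simp
      next
        fix w assume "w \<in> B"
        then show "w \<in> (\<lambda>w. map w [0..<r]) -` y \<inter> space (?P r)"
          using sub[OF B] unfolding y True sp by blast
      qed
      then show ?thesis
        using B True by simp
    qed
  qed
  then show ?thesis
    by (simp only: fin_seqs_space_def)
qed

text \<open>
  Every block is the same measurable function of a shifted segment of the row, so that measurability and the
  equality of laws transfer from segments to blocks.
\<close>

lemma block_eq_list:
  assumes "j \<ge> 1"
  shows "block X r n j = (\<lambda>\<omega>.
    map (\<lambda>i\<in>{..<r n}. (\<lambda>i\<in>{1..r n}. X n (i + (j - 1) * r n) \<omega>) (Suc i)) [0..<r n])"
proof -
  have "j * r n = (j - 1) * r n + r n"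
    using assms by (cases j) auto
  then show ?thesis
    unfolding block_def fun_eq_iff by (intro allI nth_equalityI) (auto simp: add_ac simp del: upt_Suc)
qed

lemma list_of_shifted_measurable:
  assumes "r \<ge> 1"
  shows "(\<lambda>w. map (\<lambda>i\<in>{..<r}. w (Suc i)) [0..<r]) \<in>
    measurable (PiM {1..r} (\<lambda>_. restrict_space borel E)) (fin_seqs_space E)"
proof (rule measurable_compose[OF _ upt_list_measurable[OF assms]])
  show "(\<lambda>w. \<lambda>i\<in>{..<r}. w (Suc i)) \<in>
    measurable (PiM {1..r} (\<lambda>_. restrict_space borel E)) (PiM {..<r} (\<lambda>_. restrict_space borel E))"
    by (intro measurable_restrict measurable_component_singleton) auto
qed

lemma block_index_bound:
  fixes i j n r :: nat
  assumes "j \<in> {1..n div r}" "i \<in> {1..r}"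
  shows "i + (j - 1) * r \<in> {1..n}"
proof -
  have "i + (j - 1) * r \<le> r + (j - 1) * r"
    using assms(2) by (intro add_right_mono) simp
  also have "\<dots> = j * r" using assms by (cases j) auto
  also have "\<dots> \<le> (n div r) * r" using assms by (intro mult_right_mono) auto
  also have "\<dots> \<le> n" by simp
  finally show ?thesis using assms by simp
qed

lemma block_measurable:
  assumes X: "\<And>i. i \<in> {1..n} \<Longrightarrow> X n i \<in> measurable M (restrict_space borel E)"
    and r: "r n \<ge> 1" and j: "j \<in> {1..n div r n}"
  shows "block X r n j \<in> measurable M (fin_seqs_space E)"
proof -
  have "(\<lambda>\<omega>. \<lambda>i\<in>{1..r n}. X n (i + (j - 1) * r n) \<omega>) \<in> measurable M (PiM {1..r n} (\<lambda>_. restrict_space borel E))"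
    by (intro measurable_restrict X block_index_bound[OF j])
  from measurable_compose[OF this list_of_shifted_measurable[OF r]]
  show ?thesis
    using j by (subst block_eq_list) auto
qed

lemma distr_block_eq:
  assumes X: "\<And>i. i \<in> {1..n} \<Longrightarrow> X n i \<in> measurable M (restrict_space borel E)"
    and st: "stationary_row M (restrict_space borel E) n (X n)"
    and r: "r n \<ge> 1" and j: "j \<in> {1..n div r n}"
  shows "distr M (fin_seqs_space E) (block X r n j) = distr M (fin_seqs_space E) (block X r n 1)"
proof -
  let ?S = "restrict_space borel E"
  let ?P = "PiM {1..r n} (\<lambda>_. ?S)"
  define L where "L w = map (\<lambda>i\<in>{..<r n}. w (Suc i)) [0..<r n]" for w :: "nat \<Rightarrow> 'b"
  have L: "L \<in> measurable ?P (fin_seqs_space E)"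
    unfolding L_def[abs_def] by (rule list_of_shifted_measurable[OF r])
  have *: "distr M (fin_seqs_space E) (block X r n l) =
      distr (distr M ?P (\<lambda>\<omega>. \<lambda>i\<in>{1..r n}. X n (i + (l - 1) * r n) \<omega>)) (fin_seqs_space E) L"
    if l: "l \<in> {1..n div r n}" for l
  proof -
    have "(\<lambda>\<omega>. \<lambda>i\<in>{1..r n}. X n (i + (l - 1) * r n) \<omega>) \<in> measurable M ?P"
      by (intro measurable_restrict X block_index_bound[OF l])
    from distr_distr[OF L this] show ?thesis
      using l by (simp add: comp_def L_def block_eq_list)
  qed
  have "distr M ?P (\<lambda>\<omega>. \<lambda>i\<in>{1..r n}. X n (i + (j - 1) * r n) \<omega>) = distr M ?P (\<lambda>\<omega>. \<lambda>i\<in>{1..r n}. X n i \<omega>)"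
  proof -
    have "{1..r n} \<subseteq> {1..n}"
      using block_index_bound[of 1 n "r n"] j by auto
    moreover have "(\<lambda>i. i + (j - 1) * r n) ` {1..r n} \<subseteq> {1..n}"
      using block_index_bound[OF j] by blast
    ultimately show ?thesis
      using st unfolding stationary_row_def by blast
  qed
  then show ?thesis
    using *[OF j] *[of 1] j by simp
qed

locale block_array = prob_space M for M :: "'w measure" +
  fixes E :: "'e::{topological_space, zero} set"
    and X :: "nat \<Rightarrow> nat \<Rightarrow> 'w \<Rightarrow> 'e" and r :: "nat \<Rightarrow> nat"
    and F :: "('e list \<Rightarrow> real) set" and c :: "('e list \<Rightarrow> real) \<Rightarrow> ('e list \<Rightarrow> real) \<Rightarrow> real"
  assumes X_rv: "\<And>n i. i \<in> {1..n} \<Longrightarrow> X n i \<in> measurable M (restrict_space borel E)"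
    and X_stationary: "\<And>n. stationary_row M (restrict_space borel E) n (X n)"
    and v_pos: "\<And>n. n \<ge> 1 \<Longrightarrow> nonzero_prob M X n > 0"
    and r_pos: "\<And>n. n \<ge> 1 \<Longrightarrow> r n > 0"
    and r_small: "(\<lambda>n. real (r n) / (1 / nonzero_prob M X n)) \<longlonglongrightarrow> 0"
    and v_large: "(\<lambda>n. (1 / nonzero_prob M X n) / real n) \<longlonglongrightarrow> 0"
    and F_measurable: "\<And>f. f \<in> F \<Longrightarrow> f \<in> borel_measurable (fin_seqs_space E)"
    and F_integrable: "\<And>f n. f \<in> F \<Longrightarrow> num_blocks r n \<ge> 1 \<Longrightarrow> integrable M (\<lambda>\<omega>. f (block X r n 1 \<omega>))"
    and lindeberg: "\<And>\<epsilon> f. \<epsilon> > 0 \<Longrightarrow> f \<in> F \<Longrightarrow>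
          (\<lambda>n. (\<integral>\<^sup>+\<omega>. ennreal ((centered_block M X r f n 1 \<omega>)\<^sup>2) *
                    indicator {\<omega>. \<bar>centered_block M X r f n 1 \<omega>\<bar> >
                                   \<epsilon> * sqrt (real n * nonzero_prob M X n)} \<omega> \<partial>M)
               / ennreal (real (r n) * nonzero_prob M X n)) \<longlonglongrightarrow> 0"
    and covariances: "\<And>f g. f \<in> F \<Longrightarrow> g \<in> F \<Longrightarrow>
          (\<lambda>n. 1 / (real (r n) * nonzero_prob M X n) *
               cov M (\<lambda>\<omega>. f (block X r n 1 \<omega>)) (\<lambda>\<omega>. g (block X r n 1 \<omega>)))
          \<longlonglongrightarrow> c f g"
    and dependence: "\<And>k fs t. (\<forall>i\<in>{1..k}. fs i \<in> F) \<Longrightarrow>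
          (\<lambda>n. dep_coeff M X r k fs t n) \<longlonglongrightarrow> 0"
begin

abbreviation scale :: "nat \<Rightarrow> real" where
  "scale n \<equiv> sqrt (real n * nonzero_prob M X n)"

lemma scale_pos: "n \<ge> 1 \<Longrightarrow> scale n > 0"
  and scale_sq: "n \<ge> 1 \<Longrightarrow> (scale n)\<^sup>2 = real n * nonzero_prob M X n"
  using v_pos[of n] by auto

lemma block_rv:
  "j \<in> {1..num_blocks r n} \<Longrightarrow> block X r n j \<in> measurable M (fin_seqs_space E)"
proof -
  assume j: "j \<in> {1..num_blocks r n}"
  then have "n \<ge> 1" by (cases n) (auto simp: num_blocks_def)
  then show ?thesis
    using j X_rv r_pos[of n] unfolding num_blocks_def by (intro block_measurable) auto
qed

lemma expectation_block:
  fixes g :: "'e list \<Rightarrow> 'b::{banach, second_countable_topology}"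
  assumes g: "g \<in> borel_measurable (fin_seqs_space E)" and j: "j \<in> {1..num_blocks r n}"
  shows "(LINT \<omega>|M. g (block X r n j \<omega>)) = (LINT \<omega>|M. g (block X r n 1 \<omega>))"
proof -
  have "n \<ge> 1" using j by (cases n) (auto simp: num_blocks_def)
  have "distr M (fin_seqs_space E) (block X r n j) = distr M (fin_seqs_space E) (block X r n 1)"
    using j X_rv X_stationary r_pos[OF \<open>n \<ge> 1\<close>] unfolding num_blocks_def by (intro distr_block_eq) auto
  moreover have "1 \<in> {1..num_blocks r n}" using j by simp
  ultimately show ?thesis
    using integral_distr[OF block_rv[OF j] g] integral_distr[OF block_rv g, of 1 n] by simp
qed

lemma centered_block_rv:
  assumes "f \<in> F" "j \<in> {1..num_blocks r n}"
  shows "centered_block M X r f n j \<in> borel_measurable M"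
  unfolding centered_block_def[abs_def]
  using measurable_compose[OF block_rv[OF assms(2)] F_measurable[OF assms(1)]] by simp

lemma r_over_n: "(\<lambda>n. real (r n) / real n) \<longlonglongrightarrow> 0"
proof -
  have "(\<lambda>n. (real (r n) / (1 / nonzero_prob M X n)) * ((1 / nonzero_prob M X n) / real n)) \<longlonglongrightarrow> 0 * 0"
    by (intro tendsto_mult r_small v_large)
  moreover have "eventually (\<lambda>n. (real (r n) / (1 / nonzero_prob M X n)) * ((1 / nonzero_prob M X n) / real n) = real (r n) / real n) sequentially"
    using eventually_ge_at_top[of 1]
  proof eventually_elim
    case (elim n)
    then show ?case using v_pos[of n] by simp
  qed
  ultimately show ?thesis
    by (simp add: tendsto_cong)
qed

text \<open>
  The blocks exhaust the row up to fewer than \<open>r\<^sub>n\<close> variables, and \<open>r\<^sub>n / n\<close> is the product of the two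
  vanishing ratios \<open>r\<^sub>n v\<^sub>n\<close> and \<open>1 / (n v\<^sub>n)\<close>. This converts normalization by \<open>r\<^sub>n v\<^sub>n\<close> for one
  block into normalization by \<open>n v\<^sub>n\<close> for the sum over all blocks.
\<close>

lemma blocks_cover: "(\<lambda>n. real (num_blocks r n) * real (r n) / real n) \<longlonglongrightarrow> 1"
proof (rule tendsto_sandwich)
  show "(\<lambda>n. 1 - real (r n) / real n) \<longlonglongrightarrow> 1"
    using tendsto_diff[OF tendsto_const[of 1] r_over_n] by simp
  show "(\<lambda>_. 1 :: real) \<longlonglongrightarrow> 1" by simp
  show "eventually (\<lambda>n. 1 - real (r n) / real n \<le> real (num_blocks r n) * real (r n) / real n) sequentially"
    using eventually_ge_at_top[of 1]
  proof eventually_elim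
    case (elim n)
    have "n = n div r n * r n + n mod r n" by simp
    then have "real n = real (n div r n) * real (r n) + real (n mod r n)"
      by (metis of_nat_add of_nat_mult)
    moreover have "real (n mod r n) \<le> real (r n)"
      using r_pos[OF elim] by simp
    ultimately have "real n - real (r n) \<le> real (num_blocks r n) * real (r n)"
      by (simp add: num_blocks_def)
    then have "(real n - real (r n)) / real n \<le> real (num_blocks r n) * real (r n) / real n"
      by (rule divide_right_mono) simp
    then show ?case
      using elim by (simp add: diff_divide_distrib)
  qed
  show "eventually (\<lambda>n. real (num_blocks r n) * real (r n) / real n \<le> 1) sequentially"
  proof (rule always_eventually, rule allI)
    fix n
    have "real (num_blocks r n * r n) \<le> real n"
      unfolding num_blocks_def of_nat_le_iff by simp
    then show "real (num_blocks r n) * real (r n) / real n \<le> 1"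
      by (cases "n = 0") (simp_all add: divide_le_eq_1)
  qed
qed

lemma eventually_blocks: "eventually (\<lambda>n. num_blocks r n \<ge> 1) sequentially"
proof -
  have "eventually (\<lambda>n. real (num_blocks r n) * real (r n) / real n > 0) sequentially"
    by (rule order_tendstoD(1)[OF blocks_cover]) simp
  then show ?thesis
    by eventually_elim (simp add: Suc_le_eq zero_less_divide_iff zero_less_mult_iff)
qed

lemma nn_tail_eq:
  "(\<integral>\<^sup>+\<omega>. ennreal ((centered_block M X r f n 1 \<omega>)\<^sup>2) *
      indicator {\<omega>. \<bar>centered_block M X r f n 1 \<omega>\<bar> > \<epsilon> * scale n} \<omega> \<partial>M) =
   (\<integral>\<^sup>+\<omega>. ennreal (tail_sq (\<epsilon> * scale n) (centered_block M X r f n 1 \<omega>)) \<partial>M)"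
  by (intro nn_integral_cong) (auto simp: tail_sq_def indicator_def)

text \<open>
  The Lindeberg ratio can only be close to \<open>0\<close> if the truncated second moment is finite, and the part below
  the truncation level is bounded.
\<close>

lemma eventually_square_integrable:
  assumes f: "f \<in> F"
  shows "eventually (\<lambda>n. integrable M (\<lambda>\<omega>. (centered_block M X r f n 1 \<omega>)\<^sup>2)) sequentially"
proof -
  have "eventually (\<lambda>n. (\<integral>\<^sup>+\<omega>. ennreal (tail_sq (1 * scale n) (centered_block M X r f n 1 \<omega>)) \<partial>M)
      / ennreal (real (r n) * nonzero_prob M X n) < 1) sequentially"
    using order_tendstoD(2)[OF lindeberg[OF zero_less_one f], of 1] unfolding nn_tail_eq by simp
  then show ?thesis
    using eventually_blocks eventually_ge_at_top[of 1]
  proof eventually_elim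
    case (elim n)
    let ?Y = "centered_block M X r f n 1"
    have [measurable]: "?Y \<in> borel_measurable M"
      by (rule centered_block_rv[OF f]) (use elim(2) in simp)
    have fin: "(\<integral>\<^sup>+\<omega>. ennreal (tail_sq (scale n) (?Y \<omega>)) \<partial>M) < \<infinity>"
    proof (rule ccontr)
      assume "\<not> ?thesis"
      then have "(\<integral>\<^sup>+\<omega>. ennreal (tail_sq (scale n) (?Y \<omega>)) \<partial>M) = top"
        by (simp add: not_less top_unique)
      then show False
        using elim(1) by (simp add: ennreal_top_divide)
    qed
    have "(\<integral>\<^sup>+\<omega>. ennreal ((?Y \<omega>)\<^sup>2) \<partial>M) \<le> (\<integral>\<^sup>+\<omega>. ennreal ((scale n)\<^sup>2) + ennreal (tail_sq (scale n) (?Y \<omega>)) \<partial>M)"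
      by (intro nn_integral_mono)
        (simp add: square_le_tail_sq tail_sq_nonneg ennreal_leI flip: ennreal_plus del: real_sqrt_pow2_iff)
    also have "\<dots> = ennreal ((scale n)\<^sup>2) + (\<integral>\<^sup>+\<omega>. ennreal (tail_sq (scale n) (?Y \<omega>)) \<partial>M)"
    proof (subst nn_integral_add)
      show "(\<lambda>\<omega>. ennreal (tail_sq (scale n) (?Y \<omega>))) \<in> borel_measurable M"
        by measurable
    qed (simp_all add: emeasure_space_1)
    also have "\<dots> < \<infinity>"
      using fin by (simp add: ennreal_add_less_top)
    finally have "(\<integral>\<^sup>+\<omega>. ennreal ((?Y \<omega>)\<^sup>2) \<partial>M) < \<infinity>" .
    then show ?case
    proof (rule integrableI_nonneg[rotated 2])
      show "(\<lambda>\<omega>. (?Y \<omega>)\<^sup>2) \<in> borel_measurable M"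
        by measurable
    qed simp
  qed
qed

lemma lindeberg_real:
  assumes f: "f \<in> F" and e: "e > 0"
  shows "(\<lambda>n. (LINT \<omega>|M. tail_sq (e * scale n) (centered_block M X r f n 1 \<omega>)) / (real (r n) * nonzero_prob M X n)) \<longlonglongrightarrow> 0"
proof (rule tendsto_ennrealD)
  have "eventually (\<lambda>n.
      (\<integral>\<^sup>+\<omega>. ennreal (tail_sq (e * scale n) (centered_block M X r f n 1 \<omega>)) \<partial>M)
        / ennreal (real (r n) * nonzero_prob M X n) =
      ennreal ((LINT \<omega>|M. tail_sq (e * scale n) (centered_block M X r f n 1 \<omega>)) / (real (r n) * nonzero_prob M X n))) sequentially"
    using eventually_square_integrable[OF f] eventually_blocks eventually_ge_at_top[of 1]
  proof eventually_elim
    case (elim n)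
    have "integrable M (\<lambda>\<omega>. tail_sq (e * scale n) (centered_block M X r f n 1 \<omega>))"
      by (rule integrable_tail_sq[OF centered_block_rv[OF f] elim(1)]) (use elim(2) in simp)
    then show ?case
      using r_pos[OF elim(3)] v_pos[OF elim(3)]
      by (simp add: nn_integral_eq_integral tail_sq_nonneg divide_ennreal)
  qed
  with lindeberg[OF e f] show "(\<lambda>n. ennreal ((LINT \<omega>|M. tail_sq (e * scale n) (centered_block M X r f n 1 \<omega>)) / (real (r n) * nonzero_prob M X n)))
      \<longlonglongrightarrow> ennreal 0"
    unfolding nn_tail_eq by (simp add: tendsto_cong)
  show "eventually (\<lambda>n. 0 \<le> (LINT \<omega>|M. tail_sq (e * scale n) (centered_block M X r f n 1 \<omega>)) / (real (r n) * nonzero_prob M X n)) sequentially"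
    using eventually_ge_at_top[of 1]
  proof eventually_elim
    case (elim n)
    then show ?case
      using v_pos[OF elim] by (intro divide_nonneg_nonneg) (auto simp: tail_sq_nonneg)
  qed
qed simp

end


section \<open>Convergence of the finite-dimensional distributions\<close>

text \<open>
  A list \<open>fs\<close> may repeat a functional; collecting equal terms turns a linear combination along the list into one
  over a set of functionals.
\<close>

lemma sum_over_image:
  fixes t :: "'i \<Rightarrow> real"
  assumes "finite A"
  shows "(\<Sum>f\<in>fs ` A. (\<Sum>i | i \<in> A \<and> fs i = f. t i) * g f) = (\<Sum>i\<in>A. t i * g (fs i))"
proof -
  have "(\<Sum>i\<in>A. t i * g (fs i)) = (\<Sum>f\<in>fs ` A. \<Sum>i | i \<in> A \<and> fs i = f. t i * g (fs i))"
    by (rule sum.image_gen[OF assms])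
  also have "\<dots> = (\<Sum>f\<in>fs ` A. (\<Sum>i | i \<in> A \<and> fs i = f. t i) * g f)"
    by (intro sum.cong refl) (simp add: sum_distrib_right)
  finally show ?thesis ..
qed

lemma quad_form_image:
  fixes t :: "'i \<Rightarrow> real"
  assumes "finite A"
  shows "quad_form (fs ` A) c (\<lambda>f. \<Sum>i | i \<in> A \<and> fs i = f. t i) =
    quad_form A (\<lambda>i j. c (fs i) (fs j)) t"
proof -
  define b where "b f = (\<Sum>i | i \<in> A \<and> fs i = f. t i)" for f
  have image: "(\<Sum>f\<in>fs ` A. b f * g f) = (\<Sum>i\<in>A. t i * g (fs i))" for g
    unfolding b_def by (rule sum_over_image[OF assms])
  have "quad_form (fs ` A) c b = (\<Sum>f\<in>fs ` A. b f * (\<Sum>g\<in>fs ` A. b g * c f g))"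
    by (simp add: quad_form_def sum_distrib_left mult.assoc)
  also have "\<dots> = (\<Sum>i\<in>A. t i * (\<Sum>j\<in>A. t j * c (fs i) (fs j)))"
    unfolding image ..
  also have "\<dots> = quad_form A (\<lambda>i j. c (fs i) (fs j)) t"
    by (simp add: quad_form_def sum_distrib_left mult.assoc)
  finally show ?thesis
    unfolding b_def .
qed

context block_array begin

lemma covariance_centered:
  assumes fg: "f \<in> F" "g \<in> F" and m: "num_blocks r n \<ge> 1"
    and sq: "integrable M (\<lambda>\<omega>. (centered_block M X r f n 1 \<omega>)\<^sup>2)" "integrable M (\<lambda>\<omega>. (centered_block M X r g n 1 \<omega>)\<^sup>2)"
  shows "integrable M (\<lambda>\<omega>. centered_block M X r f n 1 \<omega> * centered_block M X r g n 1 \<omega>)"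
    "(LINT \<omega>|M. centered_block M X r f n 1 \<omega> * centered_block M X r g n 1 \<omega>) =
      cov M (\<lambda>\<omega>. f (block X r n 1 \<omega>)) (\<lambda>\<omega>. g (block X r n 1 \<omega>))"
proof -
  let ?f = "\<lambda>\<omega>. f (block X r n 1 \<omega>)" and ?g = "\<lambda>\<omega>. g (block X r n 1 \<omega>)"
  define \<mu> where "\<mu> = (LINT \<omega>|M. ?f \<omega>)"
  define \<nu> where "\<nu> = (LINT \<omega>|M. ?g \<omega>)"
  let ?F = "centered_block M X r f n 1" and ?G = "centered_block M X r g n 1"
  have int: "integrable M ?f" "integrable M ?g"
    using F_integrable fg m by auto
  have F: "?F \<omega> = ?f \<omega> - \<mu>" "?G \<omega> = ?g \<omega> - \<nu>" for \<omega>
    by (simp_all add: centered_block_def \<mu>_def \<nu>_def)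
  have meas: "?F \<in> borel_measurable M" "?G \<in> borel_measurable M"
    by (rule centered_block_rv; use fg m in simp)+
  show prod: "integrable M (\<lambda>\<omega>. ?F \<omega> * ?G \<omega>)"
  proof (rule Bochner_Integration.integrable_bound)
    show "integrable M (\<lambda>\<omega>. (?F \<omega>)\<^sup>2 + (?G \<omega>)\<^sup>2)"
      using sq by simp
    have "\<bar>u * w\<bar> \<le> u\<^sup>2 + w\<^sup>2" for u w :: real
    proof -
      have "0 \<le> (\<bar>u\<bar> - \<bar>w\<bar>)\<^sup>2" by simp
      then have "2 * (\<bar>u\<bar> * \<bar>w\<bar>) \<le> u\<^sup>2 + w\<^sup>2"
        by (simp add: power2_diff)
      moreover have "0 \<le> \<bar>u\<bar> * \<bar>w\<bar>" by simp
      ultimately show ?thesis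
        unfolding abs_mult by linarith
    qed
    then show "AE \<omega> in M. norm (?F \<omega> * ?G \<omega>) \<le> norm ((?F \<omega>)\<^sup>2 + (?G \<omega>)\<^sup>2)"
      by simp
  qed (use meas in simp)
  have eq: "?f \<omega> * ?g \<omega> = ?F \<omega> * ?G \<omega> + \<nu> * ?f \<omega> + \<mu> * ?g \<omega> - \<mu> * \<nu>" for \<omega>
    by (simp only: F) (simp add: algebra_simps)
  have "(LINT \<omega>|M. ?f \<omega> * ?g \<omega>) = (LINT \<omega>|M. ?F \<omega> * ?G \<omega>) + \<nu> * \<mu> + \<mu> * \<nu> - \<mu> * \<nu>"
    unfolding eq using prod int by (simp add: prob_space \<mu>_def \<nu>_def)
  then show "(LINT \<omega>|M. ?F \<omega> * ?G \<omega>) = cov M ?f ?g"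
    by (simp add: cov_def \<mu>_def \<nu>_def)
qed

lemma eventually_square_integrable_all:
  assumes "finite A" "\<forall>i\<in>A. fs i \<in> F"
  shows "eventually (\<lambda>n. \<forall>i\<in>A. integrable M (\<lambda>\<omega>. (centered_block M X r (fs i) n 1 \<omega>)\<^sup>2)) sequentially"
  using assms eventually_square_integrable by (intro eventually_ball_finite) auto

text \<open>
  The scalar variables \<open>\<langle>t, W\<^sub>n\<^sub>,\<^sub>j\<rangle>\<close>, for an arbitrary index set of components. To see that the
  limiting covariance is positive semidefinite, the functionals index themselves.
\<close>

definition lin_comb :: "'i set \<Rightarrow> ('i \<Rightarrow> real) \<Rightarrow> ('i \<Rightarrow> 'e list \<Rightarrow> real) \<Rightarrow> nat \<Rightarrow> nat \<Rightarrow> 'w \<Rightarrow> real" where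
  "lin_comb A t fs n j \<omega> = (\<Sum>i\<in>A. t i * (centered_block M X r (fs i) n j \<omega> / scale n))"

lemma lin_comb_rv:
  assumes "\<And>i. i \<in> A \<Longrightarrow> fs i \<in> F" "j \<in> {1..num_blocks r n}"
  shows "lin_comb A t fs n j \<in> borel_measurable M"
  unfolding lin_comb_def[abs_def]
  using centered_block_rv[OF assms(1) assms(2)] by (intro borel_measurable_sum borel_measurable_times borel_measurable_divide) auto

lemma lin_comb_square:
  "(lin_comb A t fs n j \<omega>)\<^sup>2 = (\<Sum>i\<in>A. \<Sum>k\<in>A. t i * t k *
    ((centered_block M X r (fs i) n j \<omega> * centered_block M X r (fs k) n j \<omega>) / (scale n)\<^sup>2))"
  unfolding lin_comb_def power2_eq_square sum_product
  by (intro sum.cong refl) (simp add: field_simps)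

lemma integrable_lin_comb_square:
  assumes "\<And>i. i \<in> A \<Longrightarrow> fs i \<in> F" "num_blocks r n \<ge> 1"
    and "\<forall>i\<in>A. integrable M (\<lambda>\<omega>. (centered_block M X r (fs i) n 1 \<omega>)\<^sup>2)"
  shows "integrable M (\<lambda>\<omega>. (lin_comb A t fs n 1 \<omega>)\<^sup>2)"
  unfolding lin_comb_square
  using assms by (intro Bochner_Integration.integrable_sum integrable_mult_right integrable_divide covariance_centered) auto

lemma variance_lin_comb:
  assumes A: "finite A" and fs: "\<And>i. i \<in> A \<Longrightarrow> fs i \<in> F"
  shows "(\<lambda>n. num_blocks r n * (LINT \<omega>|M. (lin_comb A t fs n 1 \<omega>)\<^sup>2)) \<longlonglongrightarrow>
    quad_form A (\<lambda>i j. c (fs i) (fs j)) t"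
proof -
  have fs': "\<forall>i\<in>A. fs i \<in> F" using fs by blast
  let ?C = "\<lambda>n i k. cov M (\<lambda>\<omega>. fs i (block X r n 1 \<omega>)) (\<lambda>\<omega>. fs k (block X r n 1 \<omega>))"
  have "(\<lambda>n. \<Sum>i\<in>A. \<Sum>k\<in>A. t i * t k * ((real (num_blocks r n) * real (r n) / real n) *
      (1 / (real (r n) * nonzero_prob M X n) * ?C n i k))) \<longlonglongrightarrow>
    (\<Sum>i\<in>A. \<Sum>k\<in>A. t i * t k * (1 * c (fs i) (fs k)))"
    using fs by (intro tendsto_sum tendsto_mult tendsto_const blocks_cover covariances) auto
  moreover have "eventually (\<lambda>n. num_blocks r n * (LINT \<omega>|M. (lin_comb A t fs n 1 \<omega>)\<^sup>2) =
    (\<Sum>i\<in>A. \<Sum>k\<in>A. t i * t k * ((real (num_blocks r n) * real (r n) / real n) *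
      (1 / (real (r n) * nonzero_prob M X n) * ?C n i k)))) sequentially"
    using eventually_blocks eventually_ge_at_top[of 1] eventually_square_integrable_all[OF A fs']
  proof eventually_elim
    case (elim n)
    let ?P = "\<lambda>i k \<omega>. centered_block M X r (fs i) n 1 \<omega> * centered_block M X r (fs k) n 1 \<omega>"
    have P: "integrable M (?P i k)" "(LINT \<omega>|M. ?P i k \<omega>) = ?C n i k" if "i \<in> A" "k \<in> A" for i k
      by (rule covariance_centered; use fs elim that in simp)+
    have "(LINT \<omega>|M. (lin_comb A t fs n 1 \<omega>)\<^sup>2) =
      (\<Sum>i\<in>A. (LINT \<omega>|M. (\<Sum>k\<in>A. t i * t k * (?P i k \<omega> / (scale n)\<^sup>2))))"
      unfolding lin_comb_square
      by (intro Bochner_Integration.integral_sum Bochner_Integration.integrable_sum integrable_mult_right integrable_divide P)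
    also have "\<dots> = (\<Sum>i\<in>A. \<Sum>k\<in>A. (LINT \<omega>|M. t i * t k * (?P i k \<omega> / (scale n)\<^sup>2)))"
      by (intro sum.cong refl Bochner_Integration.integral_sum integrable_mult_right integrable_divide P)
    also have "\<dots> = (\<Sum>i\<in>A. \<Sum>k\<in>A. t i * t k * (?C n i k / (scale n)\<^sup>2))"
      by (intro sum.cong refl) (simp only: integral_mult_right_zero integral_divide_zero P(2))
    finally have *: "num_blocks r n * (LINT \<omega>|M. (lin_comb A t fs n 1 \<omega>)\<^sup>2) =
      (\<Sum>i\<in>A. \<Sum>k\<in>A. num_blocks r n * (t i * t k * (?C n i k / (scale n)\<^sup>2)))"
      by (simp only: sum_distrib_left)
    show ?case
      unfolding * scale_sq[OF elim(2)]
      using v_pos[OF elim(2)] r_pos[OF elim(2)] by (intro sum.cong refl) (simp add: divide_simps)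
  qed
  ultimately show ?thesis
    by (simp add: tendsto_cong quad_form_def)
qed

text \<open>
  Symmetry and positive semidefiniteness are inherited from the covariances of blocks: the quadratic form of \<open>c\<close>
  is a limit of second moments.
\<close>

lemma covariance_kernel_limit: "covariance_kernel F c"
  unfolding covariance_kernel_def
proof (intro conjI ballI allI impI)
  fix f g assume fg: "f \<in> F" "g \<in> F"
  have "cov M (\<lambda>\<omega>. f (block X r n 1 \<omega>)) (\<lambda>\<omega>. g (block X r n 1 \<omega>)) =
    cov M (\<lambda>\<omega>. g (block X r n 1 \<omega>)) (\<lambda>\<omega>. f (block X r n 1 \<omega>))" for n
    by (simp add: cov_def mult.commute)
  then show "c f g = c g f"
    using covariances[OF fg] covariances[OF fg(2,1)] LIMSEQ_unique by simp
next
  fix J a assume J: "finite J \<and> J \<subseteq> F"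
  have "(\<lambda>n. num_blocks r n * (LINT \<omega>|M. (lin_comb J a (\<lambda>f. f) n 1 \<omega>)\<^sup>2)) \<longlonglongrightarrow> quad_form J c a"
    using variance_lin_comb[of J "\<lambda>f. f" a] J by auto
  then show "0 \<le> quad_form J c a"
    by (rule LIMSEQ_le_const) simp
qed

lemma lindeberg_lin_comb:
  assumes A: "finite A" and fs: "\<And>i. i \<in> A \<Longrightarrow> fs i \<in> F" and e: "e > 0"
  shows "(\<lambda>n. num_blocks r n * (LINT \<omega>|M. tail_sq e (lin_comb A t fs n 1 \<omega>))) \<longlonglongrightarrow> 0"
proof -
  have fs': "\<forall>i\<in>A. fs i \<in> F" using fs by blast
  define T where "T = 1 + (\<Sum>i\<in>A. \<bar>t i\<bar>)"
  have T: "T > 0" unfolding T_def by (simp add: add_pos_nonneg sum_nonneg)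
  let ?Y = "\<lambda>n i. centered_block M X r (fs i) n 1"
  let ?B = "\<lambda>n. T\<^sup>2 * (\<Sum>i\<in>A. (real (num_blocks r n) * real (r n) / real n) *
    ((LINT \<omega>|M. tail_sq (e / T * scale n) (?Y n i \<omega>)) / (real (r n) * nonzero_prob M X n)))"
  have "?B \<longlonglongrightarrow> T\<^sup>2 * (\<Sum>i\<in>A. 1 * 0)"
    using T e fs by (intro tendsto_mult tendsto_const tendsto_sum blocks_cover lindeberg_real) auto
  then have lim: "?B \<longlonglongrightarrow> 0" by simp
  show ?thesis
  proof (rule Lim_null_comparison[OF _ lim])
    show "eventually (\<lambda>n. norm (num_blocks r n * (LINT \<omega>|M. tail_sq e (lin_comb A t fs n 1 \<omega>))) \<le> ?B n) sequentially"
      using eventually_blocks eventually_ge_at_top[of 1] eventually_square_integrable_all[OF A fs']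
    proof eventually_elim
      case (elim n)
      have int: "integrable M (\<lambda>\<omega>. tail_sq (e / T * scale n) (?Y n i \<omega>))" if "i \<in> A" for i
        using elim that fs by (intro integrable_tail_sq centered_block_rv) auto
      have pt: "tail_sq e (lin_comb A t fs n 1 \<omega>) \<le> T\<^sup>2 * (\<Sum>i\<in>A. tail_sq (e / T * scale n) (?Y n i \<omega>) / (scale n)\<^sup>2)" for \<omega>
        using tail_sq_linear_combination[OF A e, of t "\<lambda>i. ?Y n i \<omega> / scale n"]
        unfolding lin_comb_def T_def[symmetric] tail_sq_divide[OF scale_pos[OF elim(2)]] .
      have "(LINT \<omega>|M. tail_sq e (lin_comb A t fs n 1 \<omega>)) \<le>
        (LINT \<omega>|M. T\<^sup>2 * (\<Sum>i\<in>A. tail_sq (e / T * scale n) (?Y n i \<omega>) / (scale n)\<^sup>2))"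
      proof (rule integral_mono[OF _ _ pt])
        show "integrable M (\<lambda>\<omega>. tail_sq e (lin_comb A t fs n 1 \<omega>))"
          using elim fs by (intro integrable_tail_sq lin_comb_rv integrable_lin_comb_square) auto
        show "integrable M (\<lambda>\<omega>. T\<^sup>2 * (\<Sum>i\<in>A. tail_sq (e / T * scale n) (?Y n i \<omega>) / (scale n)\<^sup>2))"
          using int by (intro integrable_mult_right Bochner_Integration.integrable_sum integrable_divide) auto
      qed
      also have "\<dots> = T\<^sup>2 * (\<Sum>i\<in>A. (LINT \<omega>|M. tail_sq (e / T * scale n) (?Y n i \<omega>)) / (scale n)\<^sup>2)"
        using int by (simp add: Bochner_Integration.integral_sum)
      finally have "num_blocks r n * (LINT \<omega>|M. tail_sq e (lin_comb A t fs n 1 \<omega>)) \<le>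
        num_blocks r n * (T\<^sup>2 * (\<Sum>i\<in>A. (LINT \<omega>|M. tail_sq (e / T * scale n) (?Y n i \<omega>)) / (scale n)\<^sup>2))"
        by (rule mult_left_mono) simp
      also have "\<dots> = ?B n"
        using v_pos[OF elim(2)] r_pos[OF elim(2)] elim(2) unfolding scale_sq[OF elim(2)]
        by (simp add: sum_distrib_left field_simps)
      finally show ?case
        by (simp add: tail_sq_nonneg)
    qed
  qed
qed

text \<open>
  The scalar central limit theorem applied to \<open>\<langle>t, W\<^sub>n\<^sub>,\<^sub>j\<rangle>\<close>. All summands of a row have the same law by
  stationarity, and their sum is the combination of the values of the empirical process with weights \<open>t\<close>.
\<close>

lemma char_emp_process:
  fixes k :: nat
  assumes fs': "\<forall>i\<in>{1..k}. fs i \<in> F"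
  shows "(\<lambda>n. CLINT \<omega>|M. iexp (\<Sum>i\<in>{1..k}. t i * emp_process M X r n (fs i) \<omega>)) \<longlonglongrightarrow>
    complex_of_real (exp (- quad_form {1..k} (\<lambda>i j. c (fs i) (fs j)) t / 2))"
proof -
  have fs: "fs i \<in> F" if "i \<in> {1..k}" for i using fs' that by blast
  let ?W = "lin_comb {1..k} t fs"
  have inner: "inner_upto k t (block_vec M X r fs n j \<omega>) = ?W n j \<omega>" for n j \<omega>
    by (simp add: inner_upto_def block_vec_def lin_comb_def)
  have inner_sum: "inner_upto k t (\<lambda>i. \<Sum>s\<in>B. block_vec M X r fs n s \<omega> i) = (\<Sum>s\<in>B. ?W n s \<omega>)" for n \<omega> B
    unfolding inner_upto_def block_vec_def lin_comb_def sum_distrib_left by (rule sum.swap)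
  have emp: "(\<Sum>i\<in>{1..k}. t i * emp_process M X r n (fs i) \<omega>) = (\<Sum>j=1..num_blocks r n. ?W n j \<omega>)" for n \<omega>
  proof -
    have "(\<Sum>i\<in>{1..k}. t i * emp_process M X r n (fs i) \<omega>) =
      (\<Sum>i\<in>{1..k}. \<Sum>j=1..num_blocks r n. t i * (centered_block M X r (fs i) n j \<omega> / scale n))"
      by (simp add: emp_process_def sum_distrib_left)
    also have "\<dots> = (\<Sum>j=1..num_blocks r n. ?W n j \<omega>)"
      unfolding lin_comb_def by (rule sum.swap)
    finally show ?thesis .
  qed
  have "(\<lambda>n. CLINT \<omega>|M. iexp (\<Sum>j=1..num_blocks r n. ?W n j \<omega>)) \<longlonglongrightarrow>
    complex_of_real (exp (- quad_form {1..k} (\<lambda>i j. c (fs i) (fs j)) t / 2))"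
  proof (rule char_row_sum_tendsto_gaussian)
    show "?W n j \<in> borel_measurable M" if "j \<in> {1..num_blocks r n}" for n j
      by (rule lin_comb_rv[OF fs that])
    show "(CLINT \<omega>|M. iexp (?W n j \<omega>)) = (CLINT \<omega>|M. iexp (?W n 1 \<omega>))" if j: "j \<in> {1..num_blocks r n}" for n j
    proof -
      have mean: "(LINT \<omega>|M. fs i (block X r n j \<omega>)) = (LINT \<omega>|M. fs i (block X r n 1 \<omega>))" if "i \<in> {1..k}" for i
        by (rule expectation_block[OF F_measurable[OF fs[OF that]] j])
      define g where "g y = iexp (\<Sum>i\<in>{1..k}. t i * ((fs i y - (LINT \<omega>|M. fs i (block X r n 1 \<omega>))) / scale n))" for y
      have "g \<in> borel_measurable (fin_seqs_space E)"
        unfolding g_def[abs_def]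
        using F_measurable[OF fs] by (intro iexp_measurable borel_measurable_sum borel_measurable_times borel_measurable_divide borel_measurable_diff) auto
      from expectation_block[OF this j] show ?thesis
        using mean by (simp add: g_def lin_comb_def centered_block_def)
    qed
    show "eventually (\<lambda>n. num_blocks r n \<ge> 1) sequentially"
      by (rule eventually_blocks)
    show "eventually (\<lambda>n. integrable M (\<lambda>\<omega>. (?W n 1 \<omega>)\<^sup>2)) sequentially"
      using eventually_blocks eventually_square_integrable_all[OF finite_atLeastAtMost fs']
    proof eventually_elim
      case (elim n)
      show ?case
        by (rule integrable_lin_comb_square[OF fs elim])
    qed
    show "eventually (\<lambda>n. (LINT \<omega>|M. ?W n 1 \<omega>) = 0) sequentially"
      using eventually_blocks
    proof eventually_elim
      case (elim n)
      have "integrable M (centered_block M X r (fs i) n 1)" "(LINT \<omega>|M. centered_block M X r (fs i) n 1 \<omega>) = 0"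
        if "i \<in> {1..k}" for i
        using F_integrable[OF fs[OF that] elim] by (simp_all add: centered_block_def[abs_def] prob_space)
      then show ?case
        by (simp add: lin_comb_def Bochner_Integration.integral_sum)
    qed
    show "(\<lambda>n. num_blocks r n * (LINT \<omega>|M. (?W n 1 \<omega>)\<^sup>2)) \<longlonglongrightarrow> quad_form {1..k} (\<lambda>i j. c (fs i) (fs j)) t"
      by (rule variance_lin_comb) (use fs in auto)
    show "(\<lambda>n. num_blocks r n * (LINT \<omega>|M. tail_sq e (?W n 1 \<omega>))) \<longlonglongrightarrow> 0" if "e > 0" for e
      by (rule lindeberg_lin_comb) (use fs that in auto)
    from dependence[OF fs', of t]
    show "(\<lambda>n. \<Sum>j=1..num_blocks r n. cmod (cov M (\<lambda>\<omega>. iexp (\<Sum>s\<in>{1..<j}. ?W n s \<omega>)) (\<lambda>\<omega>. iexp (?W n j \<omega>)))) \<longlonglongrightarrow> 0"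
      unfolding dep_coeff_def inner_sum inner .
  qed
  then show ?thesis
    unfolding emp .
qed

lemma emp_process_rv:
  assumes "f \<in> F"
  shows "emp_process M X r n f \<in> borel_measurable M"
  unfolding emp_process_def[abs_def]
  using centered_block_rv[OF assms] by (intro borel_measurable_times borel_measurable_sum) auto

theorem fdds_converge_to_gaussian:
  "\<exists>(N :: (('e list \<Rightarrow> real) \<Rightarrow> real) measure) Z.
     centered_gaussian_process N F Z c \<and> fdds_converge F M (emp_process M X r) N Z"
proof -
  obtain N :: "(('e list \<Rightarrow> real) \<Rightarrow> real) measure" and Z
    where gp: "centered_gaussian_process N F Z c"
      and Z: "\<And>f. f \<in> F \<Longrightarrow> Z f \<in> borel_measurable N"
      and ch: "\<And>J t. finite J \<Longrightarrow> J \<subseteq> F \<Longrightarrow>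
        (CLINT x|N. iexp (\<Sum>f\<in>J. t f * Z f x)) = complex_of_real (exp (- quad_form J c t / 2))"
    using ex_centered_gaussian_process[OF covariance_kernel_limit] by auto
  have N: "prob_space N"
    using gp by (simp add: centered_gaussian_process_def)
  have "fdds_converge F M (emp_process M X r) N Z"
    unfolding fdds_converge_def weak_conv_on_def
  proof (intro allI impI)
    fix k :: nat and fs and h :: "(nat \<Rightarrow> real) \<Rightarrow> real"
    assume fs': "\<forall>i\<in>{1..k}. fs i \<in> F"
    then have fs: "\<And>i. i \<in> {1..k} \<Longrightarrow> fs i \<in> F" by blast
    let ?T = "product_topology (\<lambda>_. euclideanreal) {1..k}"
    let ?P = "PiM {1..k} (\<lambda>_. borel :: real measure)"
    assume h: "continuous_map ?T euclideanreal h \<and> bounded (h ` topspace ?T)"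
    then obtain B where B: "\<And>x. x \<in> extensional {1..k} \<Longrightarrow> \<bar>h x\<bar> \<le> B"
      by (auto simp: bounded_iff PiE_def)
    have emp: "(\<lambda>\<omega>. \<lambda>i\<in>{1..k}. emp_process M X r n (fs i) \<omega>) \<in> measurable M ?P" for n
      by (intro measurable_restrict emp_process_rv fs)
    have lim: "(\<lambda>\<omega>. \<lambda>i\<in>{1..k}. Z (fs i) \<omega>) \<in> measurable N ?P"
      by (intro measurable_restrict Z fs)
    have ch_fdd: "char_fun {1..k} (fdd M' k fs Zs) t = (CLINT \<omega>|M'. iexp (\<Sum>i\<in>{1..k}. t i * Zs (fs i) \<omega>))"
      if "(\<lambda>\<omega>. \<lambda>i\<in>{1..k}. Zs (fs i) \<omega>) \<in> measurable M' ?P"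
      for M' :: "'v measure" and Zs and t :: "nat \<Rightarrow> real"
    proof -
      have "char_fun {1..k} (fdd M' k fs Zs) t =
        (CLINT \<omega>|M'. iexp (\<Sum>i\<in>{1..k}. t i * (\<lambda>i\<in>{1..k}. Zs (fs i) \<omega>) i))"
        unfolding fdd_def by (rule integral_distr[OF that]) measurable
      moreover have "(\<Sum>i\<in>{1..k}. t i * (\<lambda>i\<in>{1..k}. Zs (fs i) \<omega>) i) = (\<Sum>i\<in>{1..k}. t i * Zs (fs i) \<omega>)" for \<omega>
        by (intro sum.cong) auto
      ultimately show ?thesis
        by (simp only:)
    qed
    show "(\<lambda>n. LINT x|fdd M k fs (emp_process M X r n). h x) \<longlonglongrightarrow> (LINT x|fdd N k fs Z. h x)"
    proof (rule tendsto_char_fun_imp_tendsto_integral[where J="{1..k}" and B=B])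
      show "prob_space (fdd M k fs (emp_process M X r n))" for n
        unfolding fdd_def by (rule prob_space_distr[OF emp])
      show "prob_space (fdd N k fs Z)"
        unfolding fdd_def by (rule prob_space.prob_space_distr[OF N lim])
      fix t :: "nat \<Rightarrow> real"
      have "(CLINT x|N. iexp (\<Sum>i\<in>{1..k}. t i * Z (fs i) x)) =
        (CLINT x|N. iexp (\<Sum>f\<in>fs ` {1..k}. (\<Sum>i | i \<in> {1..k} \<and> fs i = f. t i) * Z f x))"
        by (subst sum_over_image) auto
      also have "\<dots> = complex_of_real (exp (- quad_form (fs ` {1..k}) c (\<lambda>f. \<Sum>i | i \<in> {1..k} \<and> fs i = f. t i) / 2))"
        by (rule ch) (use fs in auto)
      also have "\<dots> = complex_of_real (exp (- quad_form {1..k} (\<lambda>i j. c (fs i) (fs j)) t / 2))"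
        by (subst quad_form_image) auto
      finally show "(\<lambda>n. char_fun {1..k} (fdd M k fs (emp_process M X r n)) t) \<longlonglongrightarrow> char_fun {1..k} (fdd N k fs Z) t"
        using char_emp_process[OF fs', of t] by (simp only: ch_fdd[OF emp] ch_fdd[OF lim])
    qed (use h B in \<open>auto simp: fdd_def\<close>)
  qed
  with gp show ?thesis by blast
qed

end


theorem theorem1:
  fixes M :: "'w measure"
    and E :: "(real ^ 'd) set"
    and X :: "nat \<Rightarrow> nat \<Rightarrow> 'w \<Rightarrow> real ^ 'd"
    and r :: "nat \<Rightarrow> nat"
    and F :: "((real ^ 'd) list \<Rightarrow> real) set"
    and c :: "((real ^ 'd) list \<Rightarrow> real) \<Rightarrow> ((real ^ 'd) list \<Rightarrow> real) \<Rightarrow> real"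
  assumes M: "prob_space M"
    and E: "E \<in> sets borel" "0 \<in> E"
    and X_rv: "\<And>n i. i \<in> {1..n} \<Longrightarrow> X n i \<in> measurable M (restrict_space borel E)"
    and X_stationary: "\<And>n. stationary_row M (restrict_space borel E) n (X n)"
    and v_pos: "\<And>n. n \<ge> 1 \<Longrightarrow> nonzero_prob M X n > 0"
    and r_pos: "\<And>n. n \<ge> 1 \<Longrightarrow> r n > 0"
    and r_small: "(\<lambda>n. real (r n) / (1 / nonzero_prob M X n)) \<longlonglongrightarrow> 0"
    and v_large: "(\<lambda>n. (1 / nonzero_prob M X n) / real n) \<longlonglongrightarrow> 0"
    and F: "\<And>f. f \<in> F \<Longrightarrow> cluster_functional E f"
    and F_integrable: "\<And>f n. f \<in> F \<Longrightarrow> num_blocks r n \<ge> 1 \<Longrightarrow>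
          integrable M (\<lambda>\<omega>. f (block X r n 1 \<omega>))"
    and lindeberg: "\<And>\<epsilon> f. \<epsilon> > 0 \<Longrightarrow> f \<in> F \<Longrightarrow>
          (\<lambda>n. (\<integral>\<^sup>+\<omega>. ennreal ((centered_block M X r f n 1 \<omega>)\<^sup>2) *
                    indicator {\<omega>. \<bar>centered_block M X r f n 1 \<omega>\<bar> >
                                   \<epsilon> * sqrt (real n * nonzero_prob M X n)} \<omega> \<partial>M)
               / ennreal (real (r n) * nonzero_prob M X n)) \<longlonglongrightarrow> 0"
    and covariances: "\<And>f g. f \<in> F \<Longrightarrow> g \<in> F \<Longrightarrow>
          (\<lambda>n. 1 / (real (r n) * nonzero_prob M X n) *
               cov M (\<lambda>\<omega>. f (block X r n 1 \<omega>)) (\<lambda>\<omega>. g (block X r n 1 \<omega>)))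
          \<longlonglongrightarrow> c f g"
    and dependence: "\<And>k fs t. (\<forall>i\<in>{1..k}. fs i \<in> F) \<Longrightarrow>
          (\<lambda>n. dep_coeff M X r k fs t n) \<longlonglongrightarrow> 0"
  shows "\<exists>(N :: (((real ^ 'd) list \<Rightarrow> real) \<Rightarrow> real) measure) Z.
           centered_gaussian_process N F Z c \<and>
           fdds_converge F M (emp_process M X r) N Z"
proof -
  interpret M: prob_space M by (rule M)
  interpret block_array M E X r F c
  proof
    show "f \<in> borel_measurable (fin_seqs_space E)" if "f \<in> F" for f
      using F[OF that] unfolding cluster_functional_def by blast
  qed (fact X_rv X_stationary v_pos r_pos r_small v_large F_integrable lindeberg covariances dependence)+
  show ?thesis
    by (rule fdds_converge_to_gaussian)
qed

end
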